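(* Let $T=\{x\in\mathbb{R}^n: f_1(x)=\cdots=f_{m_1}(x)=0,\ h_1(x)\ge 0,\dots,h_{m_2}(x)\ge 0\}$ be a compact set defined by polynomials $f_i,h_j$. If the PDLH condition for $T$ holds at every $u\in\partial_cT$, then $\mathrm{conv}(T)$ is SDP representable.
   Context: For a set $T\subseteq\mathbb{R}^n$, the convex boundary is $\partial_cT=\{u\in T:\ \ell^Tu=\min_{x\in T}\ell^Tx\text{ for some }\ell\in\mathbb{R}^n\text{ with }\|\ell\|=1\}\subseteq\partial T$. A set $S\subseteq\mathbb{R}^n$ is SDP representable if there are $N\ge 0$ and real symmetric matrices $A_0,A_1,\dots,A_n,B_1,\dots,B_N$ of a common size such that $S=\{x\in\mathbb{R}^n:\exists u\in\mathbb{R}^N,\ A_0+\sum_{i=1}^n x_iA_i+\sum_{j=1}^N u_jB_j\succeq 0\}$, where $\succeq 0$ means positive semidefinite (and $\succ 0$ positive definite). PDLH (positive definite Lagrange Hessian) condition. Let $T$ be given by the polynomials $f_1,\dots,f_{m_1}$ (equalities) and $h_1,\dots,h_{m_2}$ (inequalities), and let $u\in\partial T$. Then $T$ satisfies the PDLH condition at $u$ if there exists $\delta_u>0$ such that for every unit vector $\ell\in\mathbb{R}^n$ and every $0<\delta\le\delta_u$ the following holds. Put $m=m_2+1$ and $h_m(x)=\delta^2-\|x-u\|^2$. For any global minimizer $v$ of $\ell^Tx$ subject to $f_1(x)=\cdots=f_{m_1}(x)=0$, $h_1(x)\ge0,\dots,h_{m_2}(x)\ge 0$, $h_m(x)\ge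 0$, the first order optimality (KKT) condition holds, i.e. there exist $\lambda_1,\dots,\lambda_{m_1}\in\mathbb{R}$ and $\mu_1,\dots,\mu_m\ge 0$ with $$\ell=\sum_{i=1}^{m_1}\lambda_i\nabla f_i(v)+\sum_{j=1}^m\mu_j\nabla h_j(v),\qquad \mu_jh_j(v)=0\ (1\le j\le m),$$ and the Hessian of the associated Lagrange function satisfies $$-\sum_{i=1}^{m_1}\lambda_i\nabla^2f_i(x)-\sum_{j=1}^m\mu_j\nabla^2h_j(x)\succ 0\quad\text{for all }x\text{ with }\|x-u\|\le\delta.$$ *)

theory Defs
  imports "HOL-Analysis.Analysis"
begin

text \<open>Polynomials on \<open>\<real>\<^sup>n\<close> are the functions satisfying the library predicate
  \<open>real_polynomial_function\<close> on \<open>real ^ 'n\<close>.\<close>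

definition partial_deriv :: "'n::finite \<Rightarrow> (real ^ 'n \<Rightarrow> real) \<Rightarrow> real ^ 'n \<Rightarrow> real" where
  "partial_deriv i f x = frechet_derivative f (at x) (axis i 1)"

definition gradient :: "(real ^ 'n \<Rightarrow> real) \<Rightarrow> real ^ 'n \<Rightarrow> real ^ 'n::finite" where
  "gradient f x = (\<chi> i. partial_deriv i f x)"

definition hessian :: "(real ^ 'n \<Rightarrow> real) \<Rightarrow> real ^ 'n \<Rightarrow> real ^ 'n ^ 'n::finite" where
  "hessian f x = (\<chi> i j. partial_deriv i (partial_deriv j f) x)"

definition pos_definite :: "real ^ 'n ^ 'n::finite \<Rightarrow> bool" where
  "pos_definite M \<longleftrightarrow> transpose M = M \<and> (\<forall>z. z \<noteq> 0 \<longrightarrow> z \<bullet> (M *v z) > 0)"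

definition feasible_set ::
  "nat \<Rightarrow> (nat \<Rightarrow> real ^ 'n \<Rightarrow> real) \<Rightarrow> nat \<Rightarrow> (nat \<Rightarrow> real ^ 'n \<Rightarrow> real) \<Rightarrow> (real ^ 'n::finite) set" where
  "feasible_set m1 f m2 h =
     {x. (\<forall>i\<in>{1..m1}. f i x = 0) \<and> (\<forall>j\<in>{1..m2}. h j x \<ge> 0)}"

definition is_global_minimizer :: "real ^ 'n \<Rightarrow> (real ^ 'n::finite) set \<Rightarrow> real ^ 'n \<Rightarrow> bool" where
  "is_global_minimizer l S v \<longleftrightarrow> v \<in> S \<and> (\<forall>x\<in>S. l \<bullet> v \<le> l \<bullet> x)"

definition convex_boundary :: "(real ^ 'n::finite) set \<Rightarrow> (real ^ 'n) set" where
  "convex_boundary T = {u \<in> T. \<exists>l. norm l = 1 \<and> is_global_minimizer l T u}"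

text \<open>The added ball constraint has index \<open>m2 + 1\<close>. The Hessian requirement concerns the same
  multipliers that witness the first order condition.\<close>

definition PDLH ::
  "nat \<Rightarrow> (nat \<Rightarrow> real ^ 'n \<Rightarrow> real) \<Rightarrow> nat \<Rightarrow> (nat \<Rightarrow> real ^ 'n \<Rightarrow> real) \<Rightarrow> real ^ 'n::finite \<Rightarrow> bool" where
  "PDLH m1 f m2 h u \<longleftrightarrow>
     (\<exists>\<delta>\<^sub>u>0. \<forall>l \<delta>. norm l = 1 \<and> 0 < \<delta> \<and> \<delta> \<le> \<delta>\<^sub>u \<longrightarrow>
       (let m = m2 + 1; g = h(m := (\<lambda>x. \<delta>\<^sup>2 - (norm (x - u))\<^sup>2)) in
         \<forall>v. is_global_minimizer l (feasible_set m1 f m g) v \<longrightarrow>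
           (\<exists>lam mu.
              (\<forall>j\<in>{1..m}. mu j \<ge> 0) \<and>
              l = (\<Sum>i=1..m1. lam i *\<^sub>R gradient (f i) v) + (\<Sum>j=1..m. mu j *\<^sub>R gradient (g j) v) \<and>
              (\<forall>j\<in>{1..m}. mu j * g j v = 0) \<and>
              (\<forall>x. norm (x - u) \<le> \<delta> \<longrightarrow>
                 pos_definite (- (\<Sum>i=1..m1. lam i *\<^sub>R hessian (f i) x)
                               - (\<Sum>j=1..m. mu j *\<^sub>R hessian (g j) x))))))"

text \<open>The size \<open>k\<close> of the matrices in a linear matrix inequality is existentially quantified, so it
  cannot be a type; a \<open>k \<times> k\<close> matrix is a function \<open>nat \<Rightarrow> nat \<Rightarrow> real\<close> of which only the entries with
  both indices below \<open>k\<close> matter.\<close>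

definition sym_mat :: "nat \<Rightarrow> (nat \<Rightarrow> nat \<Rightarrow> real) \<Rightarrow> bool" where
  "sym_mat k M \<longleftrightarrow> (\<forall>a<k. \<forall>b<k. M a b = M b a)"

definition pos_semidefinite :: "nat \<Rightarrow> (nat \<Rightarrow> nat \<Rightarrow> real) \<Rightarrow> bool" where
  "pos_semidefinite k M \<longleftrightarrow>
     sym_mat k M \<and> (\<forall>z :: nat \<Rightarrow> real. (\<Sum>a<k. \<Sum>b<k. z a * M a b * z b) \<ge> 0)"

definition SDP_representable :: "(real ^ 'n::finite) set \<Rightarrow> bool" where
  "SDP_representable S \<longleftrightarrow>
     (\<exists>(N::nat) (k::nat) A0 (A :: 'n \<Rightarrow> nat \<Rightarrow> nat \<Rightarrow> real) (B :: nat \<Rightarrow> nat \<Rightarrow> nat \<Rightarrow> real).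
        k \<ge> 1 \<and> sym_mat k A0 \<and> (\<forall>i. sym_mat k (A i)) \<and> (\<forall>j\<in>{1..N}. sym_mat k (B j)) \<and>
        S = {x. \<exists>u :: nat \<Rightarrow> real.
               pos_semidefinite k (\<lambda>a b. A0 a b + (\<Sum>i\<in>UNIV. x $ i * A i a b) + (\<Sum>j=1..N. u j * B j a b))})"

end

theory Submission
  imports Defs
begin

text \<open>Let \<open>S\<close> be the intersection of \<open>T\<close> with a small ball \<open>B\<close> around a point of the convex boundary, and \<open>K\<close> its
  convex hull. A supporting functional \<open>l\<close> of \<open>K\<close> at a frontier point \<open>b\<close> has a minimizer \<open>v\<close> on \<open>S\<close>, and
  the function \<open>F = - (\<Sum>i. \<lambda>\<^sub>i f\<^sub>i) - (\<Sum>j. \<mu>\<^sub>j h\<^sub>j)\<close> built from its multipliers is strictly convex on \<open>B\<close>,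
  nonpositive on \<open>K\<close> and satisfies \<open>F v = 0\<close>, \<open>\<nabla>F v = - l\<close>. Hence \<open>v = b\<close>. Whether \<open>F\<close> vanishes at \<open>b\<close>
  depends only on the support of the multipliers, so finitely many such functions \<open>F\<close> suffice, and
  strict convexity along segments leaving \<open>K\<close> shows that \<open>K = {x \<in> B. \<forall>F. F x \<le> 0}\<close>.

  A sublevel set of a polynomial with positive definite Hessian is semidefinite representable near each
  of its points: by polarization the polynomial is a sum of powers of linear forms, and on a small ball
  each power of degree at least three becomes representable after adding a small multiple of the square
  of the same linear form, which the quadratic part can spare. Compactness and the representability of
  convex hulls of finite unions pass from local to global, first for \<open>K\<close> and then for the convex hull
  of the convex boundary, which is that of \<open>T\<close>.\<close>

section \<open>Calculus of semidefinite representable sets\<close>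

text \<open>The part depending on \<open>x\<close> is a linear map \<open>L\<close> rather than a
  family of coefficient matrices. No basis of the ambient space is then involved, and a linear
  substitution is just a composition.\<close>

definition lmi_rep :: "nat \<Rightarrow> nat \<Rightarrow> (nat \<Rightarrow> nat \<Rightarrow> real) \<Rightarrow> ('a::real_vector \<Rightarrow> nat \<Rightarrow> nat \<Rightarrow> real) \<Rightarrow>
    (nat \<Rightarrow> nat \<Rightarrow> nat \<Rightarrow> real) \<Rightarrow> 'a set \<Rightarrow> bool" where
  "lmi_rep N k A L B S \<longleftrightarrow>
     k \<ge> 1 \<and> sym_mat k A \<and> (\<forall>x. sym_mat k (L x)) \<and> (\<forall>j. sym_mat k (B j)) \<and> (\<forall>a b. linear (\<lambda>x. L x a b)) \<and>
     (\<forall>x. x \<in> S \<longleftrightarrow> (\<exists>u. pos_semidefinite k (\<lambda>a b. A a b + L x a b + (\<Sum>j<N. u j * B j a b))))"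

text \<open>Unlike \<open>SDP_representable\<close>, this lives over an arbitrary real vector space, so that the lifting
  variables of a construction can be components of a product type and be projected away.\<close>

definition sdp :: "'a::real_vector set \<Rightarrow> bool" where
  "sdp S \<longleftrightarrow> (\<exists>N k A L B. lmi_rep N k A L B S)"

lemma sdpI:
  fixes N :: nat
  assumes "k \<ge> 1" "sym_mat k A" "\<And>x. sym_mat k (L x)" "\<And>j. sym_mat k (B j)"
    "\<And>a b. linear (\<lambda>x. L x a b)"
    "\<And>x. x \<in> S \<longleftrightarrow> (\<exists>u. pos_semidefinite k (\<lambda>a b. A a b + L x a b + (\<Sum>j<N. u j * B j a b)))"
  shows "sdp S"
proof -
  have "lmi_rep N k A L B S" using assms unfolding lmi_rep_def by blast
  then show ?thesis unfolding sdp_def by blast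
qed

lemma lmi_repD:
  assumes "lmi_rep N k A L B S"
  shows "k \<ge> 1" "sym_mat k A" "\<And>x. sym_mat k (L x)" "\<And>j. sym_mat k (B j)" "\<And>a b. linear (\<lambda>x. L x a b)"
    "\<And>x. x \<in> S \<longleftrightarrow> (\<exists>u. pos_semidefinite k (\<lambda>a b. A a b + L x a b + (\<Sum>j<N. u j * B j a b)))"
  using assms unfolding lmi_rep_def by blast+

text \<open>Expanding \<open>x\<close> in the standard basis turns the linear map \<open>L\<close>
  into the coefficient matrices \<open>L (axis i 1)\<close>. The lifting variables, counted from 0
  in \<open>lmi_rep\<close>, are shifted by one because \<open>SDP_representable\<close> counts them
  from 1.\<close>

lemma SDP_representable_if_sdp:
  fixes S :: "(real ^ 'n) set"
  assumes "sdp S" shows "SDP_representable S"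
proof -
  obtain N k A L B where d: "lmi_rep N k A L B S" using assms unfolding sdp_def by blast
  note 1 = lmi_repD(1-4)[OF d] and lin = lmi_repD(5)[OF d] and S = lmi_repD(6)[OF d]
  have L: "L x a b = (\<Sum>i\<in>UNIV. x $ i * L (axis i 1) a b)" for x a b
  proof -
    interpret linear "\<lambda>x. L x a b" by (rule lin)
    have "L x a b = L (\<Sum>i\<in>UNIV. x $ i *\<^sub>R axis i 1) a b"
      using basis_expansion[of x] by (simp add: scalar_mult_eq_scaleR)
    then show ?thesis by (simp add: sum scaleR)
  qed
  have sh: "(\<Sum>j=1..N. u j * B (j - 1) a b) = (\<Sum>j<N. u (Suc j) * B j a b)" for u :: "nat \<Rightarrow> real" and a b
    by (rule sum.reindex_bij_witness[of _ Suc "\<lambda>j. j - 1"]) auto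
  have "x \<in> S \<longleftrightarrow> (\<exists>u. pos_semidefinite k (\<lambda>a b. A a b + (\<Sum>i\<in>UNIV. x $ i * L (axis i 1) a b)
      + (\<Sum>j=1..N. u j * B (j - 1) a b)))" for x
    unfolding S sh L[symmetric]
  proof (intro iffI; elim exE)
    fix u assume "pos_semidefinite k (\<lambda>a b. A a b + L x a b + (\<Sum>j<N. u j * B j a b))"
    then show "\<exists>u. pos_semidefinite k (\<lambda>a b. A a b + L x a b + (\<Sum>j<N. u (Suc j) * B j a b))"
      by (intro exI[of _ "\<lambda>j. u (j - 1)"]) simp
  next
    fix u assume "pos_semidefinite k (\<lambda>a b. A a b + L x a b + (\<Sum>j<N. u (Suc j) * B j a b))"
    then show "\<exists>u. pos_semidefinite k (\<lambda>a b. A a b + L x a b + (\<Sum>j<N. u j * B j a b))"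
      by (rule exI[of _ "\<lambda>j. u (Suc j)"])
  qed
  with 1 show ?thesis
    unfolding SDP_representable_def
    by - (rule exI[of _ N], rule exI[of _ k], rule exI[of _ A], rule exI[of _ "\<lambda>i. L (axis i 1)"],
        rule exI[of _ "\<lambda>j. B (j - 1)"], blast)
qed

section \<open>Block matrices, intersections, linear preimages and projections\<close>

lemma sum_lessThan_add: "(\<Sum>i<m + n. g i) = (\<Sum>i<m. g i) + (\<Sum>i<n. g (m + i))"
  for g :: "nat \<Rightarrow> 'a::comm_monoid_add"
  by (induction n) (simp_all add: add.assoc)

definition block_diag :: "nat \<Rightarrow> (nat \<Rightarrow> nat \<Rightarrow> real) \<Rightarrow> (nat \<Rightarrow> nat \<Rightarrow> real) \<Rightarrow> nat \<Rightarrow> nat \<Rightarrow> real" where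
  "block_diag k M M' a b =
     (if a < k \<and> b < k then M a b else if k \<le> a \<and> k \<le> b then M' (a - k) (b - k) else 0)"

lemma sym_mat_block_diag:
  "sym_mat k M \<Longrightarrow> sym_mat l M' \<Longrightarrow> sym_mat (k + l) (block_diag k M M')"
  unfolding sym_mat_def block_diag_def by auto

text \<open>The quadratic form splits into the forms of the two blocks; test vectors supported on a
  single block recover each of them separately.\<close>

lemma pos_semidefinite_block_diag:
  "pos_semidefinite (k + l) (block_diag k M M') \<longleftrightarrow> pos_semidefinite k M \<and> pos_semidefinite l M'"
proof -
  have form: "(\<Sum>a<k + l. \<Sum>b<k + l. z a * block_diag k M M' a b * z b) =
      (\<Sum>a<k. \<Sum>b<k. z a * M a b * z b) + (\<Sum>a<l. \<Sum>b<l. z (k + a) * M' a b * z (k + b))"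
    for z :: "nat \<Rightarrow> real"
    by (simp add: sum_lessThan_add block_diag_def)
  have sym: "sym_mat (k + l) (block_diag k M M') \<longleftrightarrow> sym_mat k M \<and> sym_mat l M'"
  proof
    assume *: "sym_mat (k + l) (block_diag k M M')"
    have "M a b = M b a" if "a < k" "b < k" for a b
      using *[unfolded sym_mat_def, rule_format, of a b] that by (simp add: block_diag_def)
    moreover have "M' a b = M' b a" if "a < l" "b < l" for a b
      using *[unfolded sym_mat_def, rule_format, of "k + a" "k + b"] that by (simp add: block_diag_def)
    ultimately show "sym_mat k M \<and> sym_mat l M'" by (simp add: sym_mat_def)
  qed (simp add: sym_mat_block_diag)
  show ?thesis
    unfolding pos_semidefinite_def sym form
  proof (intro iffI conjI allI; (elim conjE)?)
    fix z :: "nat \<Rightarrow> real"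
    assume *: "\<forall>z. 0 \<le> (\<Sum>a<k. \<Sum>b<k. z a * M a b * z b) + (\<Sum>a<l. \<Sum>b<l. z (k + a) * M' a b * z (k + b))"
    show "0 \<le> (\<Sum>a<k. \<Sum>b<k. z a * M a b * z b)"
      using *[rule_format, of "\<lambda>a. if a < k then z a else 0"] by simp
    show "0 \<le> (\<Sum>a<l. \<Sum>b<l. z a * M' a b * z b)"
      using *[rule_format, of "\<lambda>a. if a < k then 0 else z (a - k)"] by simp
  qed auto
qed

text \<open>The two matrix inequalities are stacked as diagonal blocks. The lists of lifting
  variables are concatenated, so \<open>C\<close> pads each coefficient matrix by zero in the block
  of the other set.\<close>

lemma sdp_Int:
  assumes "sdp S" "sdp T" shows "sdp (S \<inter> T)"
proof -
  obtain N k A L B where d: "lmi_rep N k A L B S" using assms(1) unfolding sdp_def by blast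
  note 1 = lmi_repD(1-5)[OF d] and S = lmi_repD(6)[OF d]
  obtain N' k' A' L' B' where d: "lmi_rep N' k' A' L' B' T" using assms(2) unfolding sdp_def by blast
  note 2 = lmi_repD(1-5)[OF d] and T = lmi_repD(6)[OF d]
  define C where "C j = (if j < N then block_diag k (B j) (\<lambda>_ _. 0) else block_diag k (\<lambda>_ _. 0) (B' (j - N)))" for j
  have eq: "(\<lambda>a b. block_diag k A A' a b + block_diag k (L x) (L' x) a b + (\<Sum>j<N + N'. u j * C j a b)) =
    block_diag k (\<lambda>a b. A a b + L x a b + (\<Sum>j<N. u j * B j a b))
      (\<lambda>a b. A' a b + L' x a b + (\<Sum>j<N'. u (N + j) * B' j a b))" for x u
    by (intro ext) (auto simp: sum_lessThan_add C_def block_diag_def intro!: sum.neutral)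
  have zero: "sym_mat l (\<lambda>_ _. 0)" for l
    by (simp add: sym_mat_def)
  show ?thesis
  proof (rule sdpI[where k = "k + k'" and A = "block_diag k A A'" and L = "\<lambda>x. block_diag k (L x) (L' x)"
        and B = C and N = "N + N'"])
    show "sym_mat (k + k') (C j)" for j
      unfolding C_def using 1 2 by (simp add: sym_mat_block_diag zero)
    show "linear (\<lambda>x. block_diag k (L x) (L' x) a b)" for a b
      by (rule linearI) (simp_all add: block_diag_def linear_add[OF 1(5)] linear_scale[OF 1(5)]
          linear_add[OF 2(5)] linear_scale[OF 2(5)])
    show "x \<in> S \<inter> T \<longleftrightarrow> (\<exists>u. pos_semidefinite (k + k')
      (\<lambda>a b. block_diag k A A' a b + block_diag k (L x) (L' x) a b + (\<Sum>j<N + N'. u j * C j a b)))" for x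
      unfolding eq pos_semidefinite_block_diag Int_iff S T
    proof (intro iffI; (elim conjE exE)?)
      fix u u'
      assume "pos_semidefinite k (\<lambda>a b. A a b + L x a b + (\<Sum>j<N. u j * B j a b))"
        "pos_semidefinite k' (\<lambda>a b. A' a b + L' x a b + (\<Sum>j<N'. u' j * B' j a b))"
      then show "\<exists>u. pos_semidefinite k (\<lambda>a b. A a b + L x a b + (\<Sum>j<N. u j * B j a b)) \<and>
         pos_semidefinite k' (\<lambda>a b. A' a b + L' x a b + (\<Sum>j<N'. u (N + j) * B' j a b))"
        by (intro exI[of _ "\<lambda>j. if j < N then u j else u' (j - N)"]) simp
    next
      fix u
      assume "pos_semidefinite k (\<lambda>a b. A a b + L x a b + (\<Sum>j<N. u j * B j a b))"
         "pos_semidefinite k' (\<lambda>a b. A' a b + L' x a b + (\<Sum>j<N'. u (N + j) * B' j a b))"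
      then show "(\<exists>u. pos_semidefinite k (\<lambda>a b. A a b + L x a b + (\<Sum>j<N. u j * B j a b))) \<and>
         (\<exists>u. pos_semidefinite k' (\<lambda>a b. A' a b + L' x a b + (\<Sum>j<N'. u j * B' j a b)))"
        by (intro conjI exI[of _ "\<lambda>j. u (N + j)"] exI[of _ u])
    qed
  qed (use 1 2 in \<open>auto intro: sym_mat_block_diag\<close>)
qed

lemma sdp_vimage:
  assumes "sdp S" "linear g" shows "sdp {y. c + g y \<in> S}"
proof -
  obtain N k A L B where d: "lmi_rep N k A L B S" using assms(1) unfolding sdp_def by blast
  note 1 = lmi_repD(1-4)[OF d] and lin = lmi_repD(5)[OF d] and S = lmi_repD(6)[OF d]
  have add: "L (x + y) a b = L x a b + L y a b" for x y a b
    using linear_add[OF lin] .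
  show ?thesis
  proof (rule sdpI[where k = k and A = "\<lambda>a b. A a b + L c a b" and L = "\<lambda>y. L (g y)" and B = B and N = N])
    show "linear (\<lambda>y. L (g y) a b)" for a b
      using linear_compose[OF assms(2) lin] by (simp add: o_def)
    show "y \<in> {y. c + g y \<in> S} \<longleftrightarrow>
       (\<exists>u. pos_semidefinite k (\<lambda>a b. A a b + L c a b + L (g y) a b + (\<Sum>j<N. u j * B j a b)))" for y
      by (simp add: S add add.assoc)
    show "sym_mat k (\<lambda>a b. A a b + L c a b)" using 1(2,3) by (simp add: sym_mat_def)
  qed (use 1 in auto)
qed

lemma sdp_vimage_linear: "sdp S \<Longrightarrow> linear g \<Longrightarrow> sdp {y. g y \<in> S}"
  using sdp_vimage[of S g 0] by simp

text \<open>The coordinates of the component projected away become additional lifting variables,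
  with coefficient matrices \<open>L (0, e i)\<close>.\<close>

lemma sdp_proj:
  fixes S :: "('a::real_vector \<times> 'b::euclidean_space) set"
  assumes "sdp S" shows "sdp {x. \<exists>y. (x, y) \<in> S}"
proof -
  obtain N k A L B where d: "lmi_rep N k A L B S" using assms(1) unfolding sdp_def by blast
  note 1 = lmi_repD(1-4)[OF d] and lin = lmi_repD(5)[OF d] and S = lmi_repD(6)[OF d]
  obtain e where e: "bij_betw e {..<DIM('b)} (Basis :: 'b set)"
    using ex_bij_betw_nat_finite[OF finite_Basis] by (metis atLeast0LessThan)
  define C where "C j = (if j < N then B j else L (0, e (j - N)))" for j
  have lin0: "linear (\<lambda>x. L (x, 0) a b)" for a b
    using linear_compose[of "\<lambda>x. (x, 0)", OF linearI lin[of a b]] by (simp add: o_def)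
  have lin1: "linear (\<lambda>y. L (0, y) a b)" for a b
    using linear_compose[of "\<lambda>y. (0, y)", OF linearI lin[of a b]] by (simp add: o_def)
  have split: "L (x, y) a b = L (x, 0) a b + L (0, y) a b" for x y a b
    using linear_add[OF lin, of "(x, 0)" "(0, y)" a b] by simp
  have expand: "(\<Sum>i<DIM('b). (y \<bullet> e i) *\<^sub>R e i) = y" for y :: 'b
    using sum.reindex_bij_betw[OF e, of "\<lambda>b. (y \<bullet> b) *\<^sub>R b"] by (simp add: euclidean_representation)
  have lsum: "(\<Sum>i<DIM('b). u i * L (0, e i) a b) = L (0, \<Sum>i<DIM('b). u i *\<^sub>R e i) a b" for u :: "nat \<Rightarrow> real" and a b
    using linear_sum[OF lin1, of _ "{..<DIM('b)}" a b] linear_scale[OF lin1] by simp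
  have Csum: "(\<Sum>j<N + DIM('b). u j * C j a b) =
      (\<Sum>j<N. u j * B j a b) + L (0, \<Sum>i<DIM('b). u (N + i) *\<^sub>R e i) a b" for u a b
    by (simp add: sum_lessThan_add C_def lsum)
  show ?thesis
  proof (rule sdpI[where k = k and A = A and L = "\<lambda>x. L (x, 0)" and B = C and N = "N + DIM('b)"])
    show "x \<in> {x. \<exists>y. (x, y) \<in> S} \<longleftrightarrow>
       (\<exists>u. pos_semidefinite k (\<lambda>a b. A a b + L (x, 0) a b + (\<Sum>j<N + DIM('b). u j * C j a b)))" for x
      unfolding mem_Collect_eq S Csum
    proof (intro iffI; elim exE)
      fix y u assume "pos_semidefinite k (\<lambda>a b. A a b + L (x, y) a b + (\<Sum>j<N. u j * B j a b))"
      then show "\<exists>u. pos_semidefinite k (\<lambda>a b. A a b + L (x, 0) a b +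
        ((\<Sum>j<N. u j * B j a b) + L (0, \<Sum>i<DIM('b). u (N + i) *\<^sub>R e i) a b))"
        by (intro exI[of _ "\<lambda>j. if j < N then u j else y \<bullet> e (j - N)"])
          (simp add: expand split[of x y] algebra_simps)
    next
      fix u assume *: "pos_semidefinite k (\<lambda>a b. A a b + L (x, 0) a b +
        ((\<Sum>j<N. u j * B j a b) + L (0, \<Sum>i<DIM('b). u (N + i) *\<^sub>R e i) a b))"
      show "\<exists>y u. pos_semidefinite k (\<lambda>a b. A a b + L (x, y) a b + (\<Sum>j<N. u j * B j a b))"
        using * by (intro exI[of _ "\<Sum>i<DIM('b). u (N + i) *\<^sub>R e i"] exI[of _ u])
          (simp add: split[of x "sum _ _"] algebra_simps)
    qed
    show "sym_mat k (C j)" for j using 1 by (simp add: C_def)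
  qed (use 1 lin0 in auto)
qed

text \<open>This is the cone of positive semidefinite \<open>2 \<times> 2\<close> matrices with
  diagonal \<open>a\<close>, \<open>c\<close> and off-diagonal entry \<open>b\<close>. Describing it
  by its quadratic form lets membership be proved by exhibiting squares and exploited by evaluation
  at one vector.\<close>

lemma sdp_psd2: "sdp {(a, b, c :: real). \<forall>y z :: real. 0 \<le> a * y\<^sup>2 + 2 * b * y * z + c * z\<^sup>2}"
proof -
  define L where "L = (\<lambda>(a, b, c) i j. if i = (0::nat) \<and> j = (0::nat) then a :: real else if i = j then c else b)"
  have form: "pos_semidefinite 2 (L (a, b, c)) \<longleftrightarrow> (\<forall>y z :: real. 0 \<le> a * y\<^sup>2 + 2 * b * y * z + c * z\<^sup>2)" for a b c
  proof -
    have q: "(\<Sum>i<2. \<Sum>j<2. w i * L (a, b, c) i j * w j) = a * (w 0)\<^sup>2 + 2 * b * w 0 * w 1 + c * (w 1)\<^sup>2"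
      for w :: "nat \<Rightarrow> real"
      by (simp add: L_def eval_nat_numeral algebra_simps)
    have "sym_mat 2 (L (a, b, c))" by (auto simp: sym_mat_def L_def)
    moreover have "(\<forall>w. 0 \<le> a * (w (0::nat))\<^sup>2 + 2 * b * w 0 * w 1 + c * (w 1)\<^sup>2) \<longleftrightarrow>
       (\<forall>y z :: real. 0 \<le> a * y\<^sup>2 + 2 * b * y * z + c * z\<^sup>2)"
    proof (intro iffI allI)
      fix y z :: real
      assume *: "\<forall>w. 0 \<le> a * (w (0::nat))\<^sup>2 + 2 * b * w 0 * w 1 + c * (w 1)\<^sup>2"
      show "0 \<le> a * y\<^sup>2 + 2 * b * y * z + c * z\<^sup>2"
        using *[rule_format, of "\<lambda>i. if i = 0 then y else z"] by simp
    qed auto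
    ultimately show ?thesis unfolding pos_semidefinite_def q by simp
  qed
  show ?thesis
  proof (rule sdpI[where k = 2 and A = "\<lambda>_ _. 0" and L = L and B = "\<lambda>_ _ _. 0" and N = 0])
    show "sym_mat 2 (L x)" for x by (cases x) (auto simp: sym_mat_def L_def)
    show "linear (\<lambda>x. L x a b)" for a b
      by (rule linearI) (auto simp: L_def split_beta)
  qed (auto simp: sym_mat_def form)
qed

lemma sdp_nonneg: "sdp {a :: real. 0 \<le> a}"
proof -
  have "sdp {a :: real. (a, 0, 0) \<in> {(a, b, c :: real). \<forall>y z :: real. 0 \<le> a * y\<^sup>2 + 2 * b * y * z + c * z\<^sup>2}}"
    by (intro sdp_vimage_linear[OF sdp_psd2]) (auto intro!: linearI)
  moreover have "(\<forall>y. 0 \<le> a * y\<^sup>2) \<longleftrightarrow> 0 \<le> a" for a :: real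
    by (metis mult_nonneg_nonneg power_one mult_1_right zero_le_power2)
  ultimately show ?thesis by simp
qed

lemma sdp_empty: "sdp {}" and sdp_UNIV: "sdp UNIV"
  using sdp_vimage[OF sdp_nonneg linear_zero, of "-1"] sdp_vimage[OF sdp_nonneg linear_zero, of 1] by simp_all

lemma sdp_INT:
  "finite I \<Longrightarrow> (\<And>i. i \<in> I \<Longrightarrow> sdp (S i)) \<Longrightarrow> sdp (\<Inter>i\<in>I. S i)"
  by (induction I rule: finite_induct) (auto intro: sdp_UNIV sdp_Int)

lemma sdp_halfspace: "linear g \<Longrightarrow> sdp {x. c + g x \<ge> (0::real)}"
  using sdp_vimage[OF sdp_nonneg, of g c] by simp

lemma sdp_singleton: "sdp {v :: 'a::euclidean_space}"
proof -
  have "sdp (\<Inter>b\<in>Basis. {x. - (v \<bullet> b) + x \<bullet> b \<ge> 0} \<inter> {x. v \<bullet> b + - (x \<bullet> b) \<ge> 0})"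
    by (intro sdp_INT sdp_Int sdp_halfspace finite_Basis linear_compose_neg)
      (auto intro!: bounded_linear.linear bounded_linear_inner_left)
  also have "(\<Inter>b\<in>Basis. {x. - (v \<bullet> b) + x \<bullet> b \<ge> 0} \<inter> {x. v \<bullet> b + - (x \<bullet> b) \<ge> 0}) = {v}"
    by (auto intro!: euclidean_eqI[of _ v] antisym)
  finally show ?thesis .
qed

section \<open>Cones over bounded sets and convex hulls of finite unions\<close>

lemma pos_semidefinite_add_scaled:
  assumes "pos_semidefinite k M" "pos_semidefinite k M'" "s \<ge> 0" "t \<ge> 0"
  shows "pos_semidefinite k (\<lambda>a b. s * M a b + t * M' a b)"
proof -
  have "(\<Sum>a<k. \<Sum>b<k. z a * (s * M a b + t * M' a b) * z b) =
    s * (\<Sum>a<k. \<Sum>b<k. z a * M a b * z b) + t * (\<Sum>a<k. \<Sum>b<k. z a * M' a b * z b)" for z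
    by (simp add: sum_distrib_left sum.distrib[symmetric] algebra_simps)
  with assms show ?thesis unfolding pos_semidefinite_def sym_mat_def by simp
qed

text \<open>Multiplying the constant matrix by \<open>t\<close> homogenizes the inequality. For
  \<open>t > 0\<close> one divides by \<open>t\<close>; at \<open>t = 0\<close> a solution is a
  recession direction, which boundedness forces to be zero, and a point of \<open>S\<close> is then
  needed to write it as \<open>0 *\<^sub>R s\<close>.\<close>

lemma sdp_homogenization:
  fixes S :: "'a::real_normed_vector set"
  assumes "sdp S" "bounded S" "S \<noteq> {}"
  shows "sdp {(x, t). t \<ge> 0 \<and> (\<exists>s\<in>S. x = t *\<^sub>R s)}"
proof -
  obtain N k A L B where d: "lmi_rep N k A L B S" using assms(1) unfolding sdp_def by blast
  note 1 = lmi_repD(1-4)[OF d] and lin = lmi_repD(5)[OF d] and S = lmi_repD(6)[OF d]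
  define M where "M x t u = (\<lambda>a b. t * A a b + L x a b + (\<Sum>j<N. u j * B j a b))" for x t and u :: "nat \<Rightarrow> real"
  have M_comb: "(\<lambda>a b. c * M x t u a b + d * M x' t' u' a b) =
      M (c *\<^sub>R x + d *\<^sub>R x') (c * t + d * t') (\<lambda>j. c * u j + d * u' j)" for c x t u d x' t' u'
    unfolding M_def
    by (intro ext) (simp add: linear_add[OF lin] linear_scale[OF lin] algebra_simps sum.distrib sum_distrib_left)
  \<comment> \<open>The vanishing second summand gives the scaling the shape of
    \<open>pos_semidefinite_add_scaled\<close>.\<close>
  have M_scale: "(\<lambda>a b. c * M x t u a b + 0 * M x t u a b) = M (c *\<^sub>R x) (c * t) (\<lambda>j. c * u j)" for c x t u
    using M_comb[of c x t u 0 x t u] by simp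
  have SM: "x \<in> S \<longleftrightarrow> (\<exists>u. pos_semidefinite k (M x 1 u))" for x
    by (simp add: S M_def)
  have cone: "(\<exists>s\<in>S. x = t *\<^sub>R s) \<longleftrightarrow> (\<exists>u. pos_semidefinite k (M x t u))" if "t \<ge> 0" for x t
  proof
    assume "\<exists>s\<in>S. x = t *\<^sub>R s"
    then obtain s u where "x = t *\<^sub>R s" "pos_semidefinite k (M s 1 u)" using SM by blast
    with pos_semidefinite_add_scaled[of k "M s 1 u" "M s 1 u" t 0] that
    show "\<exists>u. pos_semidefinite k (M x t u)" unfolding M_scale by auto
  next
    assume "\<exists>u. pos_semidefinite k (M x t u)"
    then obtain u where u: "pos_semidefinite k (M x t u)" ..
    show "\<exists>s\<in>S. x = t *\<^sub>R s"
    proof (cases "t = 0")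
      case True
      obtain s v where s: "s \<in> S" "pos_semidefinite k (M s 1 v)" using assms(3) SM by blast
      obtain b where b: "\<And>x. x \<in> S \<Longrightarrow> norm x \<le> b" using assms(2) by (auto simp: bounded_iff)
      \<comment> \<open>\<open>x\<close> is a recession direction of the bounded set \<open>S\<close>\<close>
      have "x = 0"
      proof (rule ccontr)
        assume "x \<noteq> 0"
        \<comment> \<open>The displacement \<open>c *\<^sub>R x\<close> has norm
          \<open>b + norm s + 1\<close>, more than two points of \<open>S\<close> can be apart when
          one of them is \<open>s\<close>.\<close>
        define c where "c = (b + norm s + 1) / norm x"
        have "b \<ge> 0" using b[OF s(1)] norm_ge_zero order_trans by blast
        then have "c \<ge> 0" by (simp add: c_def)
        with pos_semidefinite_add_scaled[OF s(2) u, of 1 c] have "s + c *\<^sub>R x \<in> S"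
          unfolding M_comb SM using True by auto
        from b[OF this] have "norm (c *\<^sub>R x) \<le> b + norm s"
          using norm_triangle_ineq4[of "s + c *\<^sub>R x" s] by simp
        then show False using \<open>x \<noteq> 0\<close> \<open>c \<ge> 0\<close> by (simp add: c_def)
      qed
      with True s(1) show ?thesis by auto
    next
      case False
      with pos_semidefinite_add_scaled[OF u u, of "1 / t" 0] that
      have "(1 / t) *\<^sub>R x \<in> S" unfolding M_scale SM by auto
      with False show ?thesis by (intro bexI[of _ "(1 / t) *\<^sub>R x"]) auto
    qed
  qed
  have "sdp {(x, t). \<exists>u. pos_semidefinite k (M x t u)}"
  proof (rule sdpI[where k = k and A = "\<lambda>_ _. 0" and L = "\<lambda>(x, t) a b. t * A a b + L x a b" and B = B and N = N])
    show "linear (\<lambda>p. (\<lambda>(x, t) a b. t * A a b + L x a b) p a b)" for a b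
      by (rule linearI) (auto simp: linear_add[OF lin] linear_scale[OF lin] algebra_simps)
  qed (use 1 in \<open>auto simp: sym_mat_def M_def\<close>)
  then have "sdp ({p. 0 + snd p \<ge> 0} \<inter> {(x, t). \<exists>u. pos_semidefinite k (M x t u)})"
    by (intro sdp_Int sdp_halfspace linear_snd)
  moreover have "{p. 0 + snd p \<ge> 0} \<inter> {(x, t). \<exists>u. pos_semidefinite k (M x t u)} =
      {(x, t). t \<ge> 0 \<and> (\<exists>s\<in>S. x = t *\<^sub>R s)}" using cone by auto
  ultimately show ?thesis by simp
qed

text \<open>A point of the hull is \<open>x = y + (x - y)\<close> with \<open>y\<close> in
  \<open>t *\<^sub>R S\<close> and \<open>x - y\<close> in \<open>(1 - t) *\<^sub>R T\<close>. Both
  memberships are conditions on the homogenizations, linear in \<open>(x, y, t)\<close>, so that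
  projecting \<open>(y, t)\<close> away gives the hull.\<close>

lemma sdp_convex_hull_Un:
  fixes S T :: "'a::euclidean_space set"
  assumes "sdp S" "bounded S" "convex S" "sdp T" "bounded T" "convex T"
  shows "sdp (convex hull (S \<union> T))"
proof (cases "S = {} \<or> T = {}")
  case True
  with assms show ?thesis by (auto simp: convex_hull_eq[symmetric] hull_same)
next
  case False
  define H where "H S = {(x :: 'a, t :: real). t \<ge> 0 \<and> (\<exists>s\<in>S. x = t *\<^sub>R s)}" for S
  have "sdp (H S)" "sdp (H T)" using False assms by (auto simp: H_def intro: sdp_homogenization)
  then have "sdp ({p. (\<lambda>(x, y, t). (y, t)) p \<in> H S} \<inter> {p. (0, 1) + (\<lambda>(x, y, t). (x - y, - t)) p \<in> H T})"
    by (intro sdp_Int sdp_vimage sdp_vimage_linear linearI) (auto simp: algebra_simps)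
  from sdp_proj[OF this]
  have *: "sdp {x. \<exists>p. (x, p) \<in> {p. (\<lambda>(x, y, t). (y, t)) p \<in> H S} \<inter> {p. (0, 1) + (\<lambda>(x, y, t). (x - y, - t)) p \<in> H T}}" .
  have "{x. \<exists>p. (x, p) \<in> {p. (\<lambda>(x, y, t). (y, t)) p \<in> H S} \<inter> {p. (0, 1) + (\<lambda>(x, y, t). (x - y, - t)) p \<in> H T}}
    = convex hull (S \<union> T)" (is "?l = ?r")
  proof (intro set_eqI iffI)
    fix x assume "x \<in> ?l"
    then obtain y t where "(y, t) \<in> H S" "(x - y, 1 - t) \<in> H T" by auto
    then obtain s s' where "t \<ge> 0" "1 - t \<ge> 0" "s \<in> S" "s' \<in> T" "y = t *\<^sub>R s" "x - y = (1 - t) *\<^sub>R s'"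
      by (auto simp: H_def)
    then have "x = t *\<^sub>R s + (1 - t) *\<^sub>R s'" "t + (1 - t) = 1" by (auto simp: algebra_simps)
    with \<open>t \<ge> 0\<close> \<open>1 - t \<ge> 0\<close> \<open>s \<in> S\<close> \<open>s' \<in> T\<close> show "x \<in> ?r" 
      using False assms by (subst convex_hull_union_two) blast+
  next
    fix x assume "x \<in> ?r"
    then obtain u v s t where "x = u *\<^sub>R s + v *\<^sub>R t" "u \<ge> 0" "v \<ge> 0" "u + v = 1" "s \<in> S" "t \<in> T"
      using False assms by (subst (asm) convex_hull_union_two) blast+
    moreover from this have "v = 1 - u" by simp
    ultimately show "x \<in> ?l"
      by (intro CollectI exI[of _ "(u *\<^sub>R s, u)"]) (auto simp: H_def)
  qed
  with * show ?thesis by simp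
qed

lemma sdp_convex_hull_UN:
  fixes S :: "'i \<Rightarrow> 'a::euclidean_space set"
  assumes "finite I" "\<And>i. i \<in> I \<Longrightarrow> sdp (S i)" "\<And>i. i \<in> I \<Longrightarrow> compact (S i)" "\<And>i. i \<in> I \<Longrightarrow> convex (S i)"
  shows "sdp (convex hull (\<Union>i\<in>I. S i))"
  using assms
proof (induction I rule: finite_induct)
  case empty
  then show ?case by (simp add: sdp_empty)
next
  case (insert i I)
  have "compact (\<Union>i\<in>I. S i)" using insert by (intro compact_UN) auto
  then have "sdp (convex hull (S i \<union> convex hull (\<Union>i\<in>I. S i)))"
    using insert by (intro sdp_convex_hull_Un) (auto intro!: compact_imp_bounded compact_convex_hull)
  then show ?case by (simp add: hull_Un_right[symmetric] hull_Un)
qed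

text \<open>Finitely many of the balls cover \<open>S\<close>. The union of the corresponding pieces
  lies between \<open>S\<close> and its hull, hence has the same hull.\<close>

lemma sdp_convex_hull_local:
  fixes S :: "'a::euclidean_space set"
  assumes "compact S"
    and loc: "\<And>u. u \<in> S \<Longrightarrow> \<exists>e>0. \<exists>C. sdp C \<and> compact C \<and> convex C \<and> C \<subseteq> convex hull S \<and> S \<inter> ball u e \<subseteq> C"
  shows "sdp (convex hull S)"
proof -
  obtain e C where e: "\<And>u. u \<in> S \<Longrightarrow> e u > 0"
    and C: "\<And>u. u \<in> S \<Longrightarrow> sdp (C u) \<and> compact (C u) \<and> convex (C u) \<and> C u \<subseteq> convex hull S \<and> S \<inter> ball u (e u) \<subseteq> C u"
    using loc by metis
  obtain I where I: "I \<subseteq> S" "finite I" "S \<subseteq> (\<Union>u\<in>I. ball u (e u))"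
    by (rule compactE_image[OF assms(1), of S "\<lambda>u. ball u (e u)"]) (use e in auto)
  have "convex hull (\<Union>u\<in>I. C u) = convex hull S"
  proof
    show "convex hull (\<Union>u\<in>I. C u) \<subseteq> convex hull S"
      using C I by (intro hull_minimal) auto
    have "S \<subseteq> (\<Union>u\<in>I. C u)"
    proof
      fix x assume "x \<in> S"
      then obtain u where "u \<in> I" "x \<in> ball u (e u)" using I(3) by auto
      then have "x \<in> C u" using C[of u] I(1) \<open>x \<in> S\<close> by blast
      with \<open>u \<in> I\<close> show "x \<in> (\<Union>u\<in>I. C u)" by blast
    qed
    then show "convex hull S \<subseteq> convex hull (\<Union>u\<in>I. C u)" by (rule hull_mono)
  qed
  moreover have "sdp (convex hull (\<Union>u\<in>I. C u))"
    using C I by (intro sdp_convex_hull_UN) auto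
  ultimately show ?thesis by simp
qed

section \<open>Representable epigraphs\<close>

text \<open>The domain is carried along because powers of degree above two are handled only on
  bounded ranges, and a sum needs a domain common to its summands.\<close>

definition epi_on :: "'a set \<Rightarrow> ('a \<Rightarrow> real) \<Rightarrow> ('a \<times> real) set" where
  "epi_on D \<phi> = {(x, s). x \<in> D \<and> \<phi> x \<le> s}"

lemma sdp_epi_on_affine:
  assumes "linear g" shows "sdp (epi_on UNIV (\<lambda>x. c + g x))"
proof -
  have "linear (\<lambda>p. snd p - g (fst p))"
    using assms by (auto intro!: linearI simp: linear_add linear_scale algebra_simps)
  from sdp_halfspace[OF this, of "- c"] show ?thesis
    by (rule back_subst[of sdp]) (auto simp: epi_on_def)
qed

text \<open>The bound \<open>s\<close> is split as \<open>t + (s - t)\<close>, with \<open>t\<close>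
  bounding the first summand, and \<open>t\<close> is projected away.\<close>

lemma sdp_epi_on_add:
  assumes "sdp (epi_on D \<phi>)" "sdp (epi_on D \<psi>)"
  shows "sdp (epi_on D (\<lambda>x. \<phi> x + \<psi> x))"
proof -
  have "sdp ({p. (\<lambda>((x, s), t). (x, t)) p \<in> epi_on D \<phi>} \<inter> {p. (\<lambda>((x, s), t). (x, s - t)) p \<in> epi_on D \<psi>})"
    by (intro sdp_Int sdp_vimage_linear assms linearI) (auto simp: algebra_simps)
  from sdp_proj[OF this] show ?thesis
  proof (rule back_subst[of sdp], safe)
    fix x s assume "(x, s) \<in> epi_on D (\<lambda>x. \<phi> x + \<psi> x)"
    then show "\<exists>t. ((x, s), t) \<in> {p. (\<lambda>((x, s), t). (x, t)) p \<in> epi_on D \<phi>}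
        \<inter> {p. (\<lambda>((x, s), t). (x, s - t)) p \<in> epi_on D \<psi>}"
      by (intro exI[of _ "\<phi> x"]) (auto simp: epi_on_def)
  qed (auto simp: epi_on_def)
qed

lemma sdp_epi_on_sum:
  assumes "finite I" "sdp (epi_on D (\<lambda>_. 0))" "\<And>i. i \<in> I \<Longrightarrow> sdp (epi_on D (\<phi> i))"
  shows "sdp (epi_on D (\<lambda>x. \<Sum>i\<in>I. \<phi> i x))"
  using assms by (induction I rule: finite_induct) (auto intro: sdp_epi_on_add)

lemma sdp_epi_on_subset:
  assumes "sdp D" "sdp (epi_on E \<phi>)" "D \<subseteq> E"
  shows "sdp (epi_on D \<phi>)"
proof -
  have "sdp ({p. fst p \<in> D} \<inter> epi_on E \<phi>)"
    using assms by (intro sdp_Int sdp_vimage_linear linear_fst)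
  moreover have "{p. fst p \<in> D} \<inter> epi_on E \<phi> = epi_on D \<phi>"
    using assms(3) by (auto simp: epi_on_def)
  ultimately show ?thesis by simp
qed

lemma sdp_sublevel:
  assumes "sdp (epi_on D \<phi>)" shows "sdp {x \<in> D. \<phi> x \<le> c}"
proof -
  have "linear (\<lambda>x. (x, 0))" by (rule linearI) auto
  from sdp_vimage[OF assms this, of "(0, c)"] show ?thesis by (simp add: epi_on_def)
qed

section \<open>Squares, and higher powers through pseudo-moments\<close>

lemma psd2_one_iff: "(\<forall>y z. 0 \<le> y\<^sup>2 + 2 * t * y * z + m * z\<^sup>2) \<longleftrightarrow> t\<^sup>2 \<le> (m :: real)"
proof
  assume "\<forall>y z. 0 \<le> y\<^sup>2 + 2 * t * y * z + m * z\<^sup>2"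
  \<comment> \<open>For \<open>z = 1\<close> the form is smallest at \<open>y = - t\<close>, with
    value \<open>m - t\<^sup>2\<close>.\<close>
  from this[rule_format, of "- t" 1] show "t\<^sup>2 \<le> m" by (simp add: power2_eq_square)
next
  assume "t\<^sup>2 \<le> m"
  then have "0 \<le> (y + t * z)\<^sup>2 + (m - t\<^sup>2) * z\<^sup>2" for y z by simp
  then show "\<forall>y z. 0 \<le> y\<^sup>2 + 2 * t * y * z + m * z\<^sup>2"
    by (simp add: power2_eq_square algebra_simps)
qed

lemma sdp_square_le: "sdp {(t, m :: real). t\<^sup>2 \<le> m}"
proof -
  have "sdp {p. (1, 0, 0) + (\<lambda>(t, m). (0, t, m)) p \<in> {(a, b, c :: real). \<forall>y z :: real. 0 \<le> a * y\<^sup>2 + 2 * b * y * z + c * z\<^sup>2}}"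
    by (intro sdp_vimage sdp_psd2 linearI) auto
  then show ?thesis
    by (rule back_subst[of sdp]) (auto simp: psd2_one_iff)
qed

lemma sdp_epi_on_square:
  assumes "linear g" shows "sdp (epi_on UNIV (\<lambda>x. (g x)\<^sup>2))"
proof -
  have "linear (\<lambda>(x, s). (g x, s))"
    using assms by (auto intro!: linearI simp: linear_add linear_scale)
  from sdp_vimage_linear[OF sdp_square_le this] show ?thesis
    by (simp add: epi_on_def case_prod_unfold)
qed

text \<open>The entries \<open>m\<close>, \<open>p\<close>, \<open>q\<close> are pseudo-moments standing for the powers of exponents 2, \<open>n\<close> and
  \<open>n + 1\<close> of \<open>t\<close>. Each step of the induction only requires that \<open>(1 \<plusminus> X ^ n) * (X - y)\<^sup>2\<close> has nonnegative
  pseudo-expectation for all \<open>y\<close>, a \<open>2 \<times> 2\<close> matrix inequality; the case \<open>y = t\<close> bounds the error of the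
  next pseudo-moment by a multiple of \<open>m - t\<^sup>2\<close>.\<close>

lemma sdp_power_lift:
  assumes "n \<ge> 1"
  shows "\<exists>R. sdp R \<and> (\<forall>t. \<bar>t\<bar> \<le> 1 \<longrightarrow> (t, t\<^sup>2, t ^ n, t ^ Suc n) \<in> R) \<and>
     (\<forall>t m p q. (t, m, p, q) \<in> R \<longrightarrow> \<bar>t\<bar> \<le> 1 \<and> t\<^sup>2 \<le> m \<and> \<bar>q - t * p\<bar> \<le> real n * (m - t\<^sup>2) \<and>
        \<bar>q - t ^ Suc n\<bar> \<le> (real n)\<^sup>2 * (m - t\<^sup>2))"
  using assms
proof (induction n rule: nat_induct_at_least)
  case base
  \<comment> \<open>For exponent 1 the pseudo-moments are tied exactly: \<open>p = t\<close> and
    \<open>q = m\<close>, so both errors equal \<open>m - t\<^sup>2\<close>.\<close>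
  let ?R = "{p. (\<lambda>(t, m, p, q). (t, m)) p \<in> {(t, m :: real). t\<^sup>2 \<le> m}} \<inter> {p. (\<lambda>(t, m, p, q). (p - t, q - m)) p \<in> {(0 :: real, 0 :: real)}}
     \<inter> ({p. 1 + (\<lambda>(t, m, p, q). t) p \<ge> (0 :: real)} \<inter> {p. 1 + (\<lambda>(t, m, p, q). - t) p \<ge> (0 :: real)})"
  have "sdp ?R"
    by (intro sdp_Int sdp_vimage_linear sdp_halfspace sdp_square_le sdp_singleton linearI)
      (auto simp: algebra_simps)
  then show ?case
    by (intro exI[of _ ?R] conjI) (auto simp: abs_le_iff power2_eq_square abs_if)
next
  case (Suc n)
  then obtain R where R: "sdp R" and true: "\<And>t. \<bar>t\<bar> \<le> 1 \<Longrightarrow> (t, t\<^sup>2, t ^ n, t ^ Suc n) \<in> R"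
    and bound: "\<And>t m p q. (t, m, p, q) \<in> R \<Longrightarrow> \<bar>t\<bar> \<le> 1 \<and> t\<^sup>2 \<le> m \<and> \<bar>q - t * p\<bar> \<le> real n * (m - t\<^sup>2) \<and>
        \<bar>q - t ^ Suc n\<bar> \<le> (real n)\<^sup>2 * (m - t\<^sup>2)"
    by blast
  define P where "P = {(a, b, c :: real). \<forall>y z :: real. 0 \<le> a * y\<^sup>2 + 2 * b * y * z + c * z\<^sup>2}"
  \<comment> \<open>The tuple moves up by one exponent: \<open>q\<close> takes the place of
    \<open>p\<close>, \<open>r\<close> is the new pseudo-moment, and the old \<open>p\<close> is
    projected away. The two triples are the pseudo-moments of \<open>1 \<plusminus> X ^ n\<close>
    multiplied by \<open>1\<close>, \<open>X\<close> and \<open>X\<^sup>2\<close>.\<close>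
  define Q where "Q = {p. (\<lambda>((t, m, q, r), p). (t, m, p, q)) p \<in> R} \<inter>
     ({p. (1, 0, 0) + (\<lambda>((t, m, q, r), p). (p, t + q, m + r)) p \<in> P} \<inter>
      {p. (1, 0, 0) + (\<lambda>((t, m, q, r), p). (- p, t - q, m - r)) p \<in> P})"
  have "sdp Q"
    unfolding Q_def P_def using R
    by (intro sdp_Int sdp_vimage sdp_vimage_linear sdp_psd2 linearI) (auto simp: algebra_simps)
  then have "sdp {x. \<exists>p. (x, p) \<in> Q}" by (rule sdp_proj)
  moreover have "\<exists>p. ((t, t\<^sup>2, t ^ Suc n, t ^ Suc (Suc n)), p) \<in> Q" if t: "\<bar>t\<bar> \<le> 1" for t
  proof -
    have "\<bar>t ^ n\<bar> \<le> 1" using t by (simp add: power_abs power_le_one)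
    then have "0 \<le> (1 + t ^ n) * (y + t * z)\<^sup>2" "0 \<le> (1 - t ^ n) * (y + t * z)\<^sup>2" for y z
      by (auto intro!: mult_nonneg_nonneg)
    then have "(1 + t ^ n, t + t ^ Suc n, t\<^sup>2 + t ^ Suc (Suc n)) \<in> P" "(1 - t ^ n, t - t ^ Suc n, t\<^sup>2 - t ^ Suc (Suc n)) \<in> P"
      by (simp_all add: P_def power2_eq_square algebra_simps)
    with true[OF t] show ?thesis by (intro exI[of _ "t ^ n"]) (simp add: Q_def)
  qed
  moreover have "\<bar>t\<bar> \<le> 1 \<and> t\<^sup>2 \<le> m \<and> \<bar>r - t * q\<bar> \<le> real (Suc n) * (m - t\<^sup>2) \<and>
        \<bar>r - t ^ Suc (Suc n)\<bar> \<le> (real (Suc n))\<^sup>2 * (m - t\<^sup>2)" if mem: "((t, m, q, r), p) \<in> Q" for t m q r p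
  proof -
    have "(t, m, p, q) \<in> R" and P: "(1 + p, t + q, m + r) \<in> P" "(1 - p, t - q, m - r) \<in> P"
      using mem by (auto simp: Q_def)
    with bound have b: "\<bar>t\<bar> \<le> 1" "t\<^sup>2 \<le> m" "\<bar>q - t * p\<bar> \<le> real n * (m - t\<^sup>2)"
        "\<bar>q - t ^ Suc n\<bar> \<le> (real n)\<^sup>2 * (m - t\<^sup>2)" by blast+
    have PD: "0 \<le> a * (- t)\<^sup>2 + 2 * b * (- t) * 1 + c * 1\<^sup>2" if "(a, b, c) \<in> P" for a b c
      using that unfolding P_def by blast
    \<comment> \<open>These are the pseudo-expectations of
      \<open>(1 \<plusminus> X ^ n) * (X - t)\<^sup>2\<close>. The part free of the sign is
      \<open>m - t\<^sup>2\<close>, so it bounds the absolute value of the part that changes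
      sign.\<close>
    have "0 \<le> (1 + p) * t\<^sup>2 - 2 * (t + q) * t + (m + r)" "0 \<le> (1 - p) * t\<^sup>2 - 2 * (t - q) * t + (m - r)"
      using PD[OF P(1)] PD[OF P(2)] by simp_all
    then have "\<bar>(r - t * q) - t * (q - t * p)\<bar> \<le> m - t\<^sup>2"
      unfolding abs_le_iff by (simp add: algebra_simps power2_eq_square)
    moreover have mult: "\<bar>t * x\<bar> \<le> y" if "\<bar>x\<bar> \<le> y" for x y
      using mult_mono[OF b(1) that] by (simp add: abs_mult)
    have "\<bar>t * (q - t * p)\<bar> \<le> real n * (m - t\<^sup>2)" using b(3) by (rule mult)
    ultimately have 1: "\<bar>r - t * q\<bar> \<le> real (Suc n) * (m - t\<^sup>2)"
      by (simp add: algebra_simps)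
    have "\<bar>t * (q - t ^ Suc n)\<bar> \<le> (real n)\<^sup>2 * (m - t\<^sup>2)" using b(4) by (rule mult)
    with 1 have "\<bar>r - t ^ Suc (Suc n)\<bar> \<le> (real (Suc n) + (real n)\<^sup>2) * (m - t\<^sup>2)"
      by (simp add: algebra_simps)
    \<comment> \<open>The error constant grows by \<open>n + 1\<close> in each step, and
      \<open>n\<^sup>2 + n + 1\<close> is at most \<open>(n + 1)\<^sup>2\<close>.\<close>
    also have "\<dots> \<le> (real (Suc n))\<^sup>2 * (m - t\<^sup>2)"
      using b(2) by (intro mult_right_mono) (auto simp: power2_eq_square algebra_simps)
    finally show ?thesis using 1 b by blast
  qed
  ultimately show ?case by (intro exI[of _ "{x. \<exists>p. (x, p) \<in> Q}"]) blast
qed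

text \<open>In the lifted description \<open>q\<close> replaces \<open>t ^ k\<close> and
  \<open>m\<close> replaces \<open>t\<^sup>2\<close>. The error in \<open>q\<close> is at most a
  multiple of \<open>m - t\<^sup>2\<close>, and the added square pays for it, since replacing
  \<open>t\<^sup>2\<close> by \<open>m\<close> raises that term by the same kind of quantity. The
  true powers of \<open>t\<close> give the converse inclusion.\<close>

lemma sdp_epi_on_power:
  assumes "k \<ge> 2"
  shows "sdp (epi_on {t. \<bar>t\<bar> \<le> 1} (\<lambda>t. c * t ^ k + \<bar>c\<bar> * (real k)\<^sup>2 * t\<^sup>2))"
proof -
  obtain n where k: "k = Suc n" "n \<ge> 1" using assms by (cases k) auto
  obtain R where R: "sdp R" and true: "\<And>t. \<bar>t\<bar> \<le> 1 \<Longrightarrow> (t, t\<^sup>2, t ^ n, t ^ k) \<in> R"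
    and bound: "\<And>t m p q. (t, m, p, q) \<in> R \<Longrightarrow> \<bar>t\<bar> \<le> 1 \<and> t\<^sup>2 \<le> m \<and> \<bar>q - t ^ k\<bar> \<le> (real n)\<^sup>2 * (m - t\<^sup>2)"
    using sdp_power_lift[OF k(2)] unfolding k by blast
  have "sdp ({p. (\<lambda>((t, s), m, p, q). (t, m, p, q)) p \<in> R} \<inter>
     {p. 0 + (\<lambda>((t, s), m, p, q). s - c * q - \<bar>c\<bar> * (real k)\<^sup>2 * m) p \<ge> (0 :: real)})" (is "sdp ?Q")
    by (intro sdp_Int sdp_vimage_linear sdp_halfspace R linearI) (auto simp: algebra_simps)
  from sdp_proj[OF this] show ?thesis
  proof (rule back_subst[of sdp], intro set_eqI iffI)
    fix x assume "x \<in> {x. \<exists>y. (x, y) \<in> ?Q}"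
    then obtain t s m p q where x: "x = (t, s)" and "((t, s), m, p, q) \<in> ?Q"
      by (cases x) auto
    then have mem: "(t, m, p, q) \<in> R" and s: "c * q + \<bar>c\<bar> * (real k)\<^sup>2 * m \<le> s" by auto
    have b: "\<bar>t\<bar> \<le> 1" "t\<^sup>2 \<le> m" "\<bar>q - t ^ k\<bar> \<le> (real n)\<^sup>2 * (m - t\<^sup>2)" using bound[OF mem] by auto
    note b(3)
    also have "(real n)\<^sup>2 * (m - t\<^sup>2) \<le> (real k)\<^sup>2 * (m - t\<^sup>2)"
      using b(2) by (intro mult_right_mono power_mono) (auto simp: k)
    finally have "\<bar>c * (q - t ^ k)\<bar> \<le> \<bar>c\<bar> * ((real k)\<^sup>2 * (m - t\<^sup>2))"
      unfolding abs_mult by (rule mult_left_mono) simp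
    then have "c * t ^ k + \<bar>c\<bar> * (real k)\<^sup>2 * t\<^sup>2 \<le> c * q + \<bar>c\<bar> * (real k)\<^sup>2 * m"
      by (simp add: algebra_simps abs_le_iff)
    with s b(1) show "x \<in> epi_on {t. \<bar>t\<bar> \<le> 1} (\<lambda>t. c * t ^ k + \<bar>c\<bar> * (real k)\<^sup>2 * t\<^sup>2)"
      by (simp add: epi_on_def x)
  next
    fix x assume x: "x \<in> epi_on {t. \<bar>t\<bar> \<le> 1} (\<lambda>t. c * t ^ k + \<bar>c\<bar> * (real k)\<^sup>2 * t\<^sup>2)"
    obtain t s where "x = (t, s)" by (cases x)
    with x show "x \<in> {x. \<exists>y. (x, y) \<in> ?Q}"
      using true[of t] by (intro CollectI exI[of _ "(t\<^sup>2, t ^ n, t ^ k)"]) (auto simp: epi_on_def)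
  qed
qed

text \<open>The substitution \<open>t = (a \<bullet> z) / \<rho>\<close> reduces to the unit
  interval; the factor \<open>\<rho> ^ (k - 2)\<close> is what remains of \<open>\<rho> ^ k\<close>
  after the square is rescaled.\<close>

lemma sdp_epi_on_inner_power:
  fixes a :: "'a::real_inner"
  assumes "k \<ge> 2" "\<rho> > 0"
  shows "sdp (epi_on {z. \<bar>a \<bullet> z\<bar> \<le> \<rho>} (\<lambda>z. c * (a \<bullet> z) ^ k + \<bar>c\<bar> * (real k)\<^sup>2 * \<rho> ^ (k - 2) * (a \<bullet> z)\<^sup>2))"
proof -
  have "sdp {p. (\<lambda>(z, s). ((a \<bullet> z) / \<rho>, s)) p \<in>
      epi_on {t. \<bar>t\<bar> \<le> 1} (\<lambda>t. (c * \<rho> ^ k) * t ^ k + \<bar>c * \<rho> ^ k\<bar> * (real k)\<^sup>2 * t\<^sup>2)}"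
    by (intro sdp_vimage_linear sdp_epi_on_power assms linearI)
      (auto simp: inner_add_right add_divide_distrib)
  moreover have "(c * \<rho> ^ k) * ((a \<bullet> z) / \<rho>) ^ k = c * (a \<bullet> z) ^ k" for z
    using assms by (simp add: power_divide)
  moreover have "\<bar>c * \<rho> ^ k\<bar> * (real k)\<^sup>2 * ((a \<bullet> z) / \<rho>)\<^sup>2 = \<bar>c\<bar> * (real k)\<^sup>2 * \<rho> ^ (k - 2) * (a \<bullet> z)\<^sup>2" for z
  proof -
    have "\<rho> ^ k = \<rho> ^ (k - 2) * \<rho>\<^sup>2" using assms by (metis power_add le_add_diff_inverse2)
    with assms show ?thesis by (simp add: power_divide abs_mult)
  qed
  ultimately show ?thesis
    using assms by (simp add: epi_on_def case_prod_unfold abs_divide pos_divide_le_eq)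
qed

section \<open>Positive semidefinite quadratic forms\<close>

lemma psd_bilinear_Cauchy_Schwarz:
  fixes b :: "'a::real_vector \<Rightarrow> 'a \<Rightarrow> real"
  assumes "bilinear b" "\<And>x y. b x y = b y x" "\<And>x. b x x \<ge> 0"
  shows "(b e x)\<^sup>2 \<le> b e e * b x x"
proof -
  have "0 \<le> b (b e e *\<^sub>R x - b e x *\<^sub>R e) (b e e *\<^sub>R x - b e x *\<^sub>R e)" by (rule assms)
  also have "\<dots> = b e e * (b e e * b x x - (b e x)\<^sup>2)"
    by (simp add: bilinear_lsub[OF assms(1)] bilinear_rsub[OF assms(1)] bilinear_lmul[OF assms(1)]
        bilinear_rmul[OF assms(1)] assms(2)[of x e] power2_eq_square algebra_simps)
  finally have 1: "0 \<le> b e e * (b e e * b x x - (b e x)\<^sup>2)" .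
  have 2: "0 \<le> b x x * ((b x x * b e e) - (b e x)\<^sup>2)"
  proof -
    have "0 \<le> b (b x x *\<^sub>R e - b e x *\<^sub>R x) (b x x *\<^sub>R e - b e x *\<^sub>R x)" by (rule assms)
    also have "\<dots> = b x x * ((b x x * b e e) - (b e x)\<^sup>2)"
      by (simp add: bilinear_lsub[OF assms(1)] bilinear_rsub[OF assms(1)] bilinear_lmul[OF assms(1)]
          bilinear_rmul[OF assms(1)] assms(2)[of x e] power2_eq_square algebra_simps)
    finally show ?thesis .
  qed
  show ?thesis
  proof (cases "b e e = 0 \<and> b x x = 0")
    case True
    \<comment> \<open>With both diagonal values zero, the form at this vector is
      \<open>- 2 * (b e x)\<^sup>2\<close>.\<close>
    have "0 \<le> b (x - b e x *\<^sub>R e) (x - b e x *\<^sub>R e)" by (rule assms)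
    with True have "(b e x)\<^sup>2 \<le> 0"
      by (simp add: bilinear_lsub[OF assms(1)] bilinear_rsub[OF assms(1)] bilinear_lmul[OF assms(1)]
        bilinear_rmul[OF assms(1)] assms(2)[of x e] power2_eq_square algebra_simps)
    with True show ?thesis by simp
  next
    case False
    with assms(3)[of e] assms(3)[of x] have "b e e > 0 \<or> b x x > 0" by (auto simp: less_le)
    with 1 2 show ?thesis by (auto simp: zero_le_mult_iff mult.commute)
  qed
qed

text \<open>Successive completion of squares writes the form as a sum of squares of linear forms.
  The induction is over the basis vectors not yet known to lie in the kernel of the form; a pivot
  with \<open>b e e = 0\<close> is already there by Cauchy-Schwarz.\<close>

lemma sdp_epi_on_psd_bilinear:
  fixes b :: "'a::euclidean_space \<Rightarrow> 'a \<Rightarrow> real"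
  assumes "bilinear b" "\<And>x y. b x y = b y x" "\<And>x. b x x \<ge> 0"
  shows "sdp (epi_on UNIV (\<lambda>x. b x x))"
proof -
  have "sdp (epi_on UNIV (\<lambda>x. b x x))"
    if "finite A" "bilinear b" "\<And>x y. b x y = b y x" "\<And>x. b x x \<ge> 0" "\<And>e x. e \<in> Basis - A \<Longrightarrow> b e x = 0"
    for A and b :: "'a \<Rightarrow> 'a \<Rightarrow> real"
    using that
  proof (induction A arbitrary: b rule: finite_induct)
    case empty
    have "b x x = 0" for x
    proof -
      have "b x x = b (\<Sum>e\<in>Basis. (x \<bullet> e) *\<^sub>R e) x" by (simp add: euclidean_representation)
      also have "\<dots> = (\<Sum>e\<in>Basis. (x \<bullet> e) * b e x)"
        using empty(1) by (simp add: bilinear_def linear_sum[where f = "\<lambda>y. b y x"] linear_scale[where f = "\<lambda>y. b y x"])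
      finally show ?thesis using empty(4) by simp
    qed
    then show ?case using sdp_epi_on_affine[OF linear_zero, of 0] by simp
  next
    case (insert e A)
    note add = bilinear_ladd[OF insert.prems(1)] bilinear_radd[OF insert.prems(1)]
      bilinear_lmul[OF insert.prems(1)] bilinear_rmul[OF insert.prems(1)]
    note cs = psd_bilinear_Cauchy_Schwarz[OF insert.prems(1-3)]
    show ?case
    proof (cases "b e e = 0")
      case True
      have "b e' x = 0" if "e' \<in> Basis - A" for e' x
        using True cs[of e x] insert.prems(4)[of e' x] that by (cases "e' = e") auto
      then show ?thesis using insert.prems by (intro insert.IH[of b]) auto
    next
      case False
      then have pos: "b e e > 0" using insert.prems(3)[of e] by simp
      \<comment> \<open>Subtracting the square belonging to the pivot \<open>e\<close> puts
        \<open>e\<close> into the kernel; what remains is still positive semidefinite by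
        Cauchy-Schwarz.\<close>
      define b' where "b' x y = b x y - b e x * b e y / b e e" for x y
      have "sdp (epi_on UNIV (\<lambda>x. b' x x))"
      proof (rule insert.IH[of b'])
        show "bilinear b'"
          unfolding bilinear_def b'_def
          by (intro conjI allI linearI) (simp_all add: add field_simps pos[THEN less_imp_neq, symmetric])
        show "b' x y = b' y x" for x y by (simp add: b'_def insert.prems(2)[of x y] mult.commute)
        show "0 \<le> b' x x" for x
          using cs[of e x] pos by (simp add: b'_def pos_divide_le_eq power2_eq_square mult.commute)
        show "b' e' x = 0" if "e' \<in> Basis - A" for e' x
        proof (cases "e' = e")
          case False
          then have "b e' x = 0" for x using that insert.prems(4) by auto
          then show ?thesis by (simp add: b'_def insert.prems(2)[of e e'])
        qed (use pos in \<open>simp add: b'_def\<close>)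
      qed
      moreover have "sdp (epi_on UNIV (\<lambda>x. (b e x / sqrt (b e e))\<^sup>2))"
        using add by (intro sdp_epi_on_square linearI) (simp_all add: add_divide_distrib)
      ultimately have "sdp (epi_on UNIV (\<lambda>x. b' x x + (b e x / sqrt (b e e))\<^sup>2))" by (rule sdp_epi_on_add)
      moreover have "b' x x + (b e x / sqrt (b e e))\<^sup>2 = b x x" for x
        using pos by (simp add: b'_def power_divide power2_eq_square)
      ultimately show ?thesis by simp
    qed
  qed
  from this[OF finite_Basis assms] show ?thesis by auto
qed

lemma sdp_cball_0: "sdp (cball (0 :: 'a::euclidean_space) r)"
proof (cases "r \<ge> 0")
  case True
  have "sdp {x \<in> UNIV. (x :: 'a) \<bullet> x \<le> r\<^sup>2}" for r :: real
    by (intro sdp_sublevel sdp_epi_on_psd_bilinear[where b = "(\<bullet>)"])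
      (auto simp: bilinear_def inner_commute inner_add_left inner_add_right intro!: linearI)
  then show ?thesis
    by (rule back_subst[of sdp]) (use True in \<open>auto simp: norm_le_square\<close>)
qed (simp add: sdp_empty)

section \<open>Polarization and local representability\<close>

text \<open>The terms form a list, so that sums are concatenations and linear forms may repeat; the
  exponents need not agree.\<close>

definition pow_sum :: "('a::real_inner \<Rightarrow> real) \<Rightarrow> bool" where
  "pow_sum f \<longleftrightarrow> (\<exists>xs. f = (\<lambda>z. \<Sum>(c, a, k)\<leftarrow>xs. c * (a \<bullet> z) ^ k))"

lemma pow_sum_power: "pow_sum (\<lambda>z. c * (a \<bullet> z) ^ k)"
  unfolding pow_sum_def by (rule exI[of _ "[(c, a, k)]"]) simp

lemma pow_sum_const: "pow_sum (\<lambda>z. c)"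
  using pow_sum_power[of c 0 0] by simp

lemma pow_sum_add: "pow_sum f \<Longrightarrow> pow_sum g \<Longrightarrow> pow_sum (\<lambda>z. f z + g z)"
  unfolding pow_sum_def
proof (elim exE)
  fix xs ys
  assume "f = (\<lambda>z. \<Sum>(c, a, k)\<leftarrow>xs. c * (a \<bullet> z) ^ k)" "g = (\<lambda>z. \<Sum>(c, a, k)\<leftarrow>ys. c * (a \<bullet> z) ^ k)"
  then show "\<exists>xs. (\<lambda>z. f z + g z) = (\<lambda>z. \<Sum>(c, a, k)\<leftarrow>xs. c * (a \<bullet> z) ^ k)"
    by (intro exI[of _ "xs @ ys"]) simp
qed

lemma pow_sum_induct [consumes 1, case_names zero add]:
  assumes "pow_sum f" "P (\<lambda>z. 0)" "\<And>c a k g. pow_sum g \<Longrightarrow> P g \<Longrightarrow> P (\<lambda>z. c * (a \<bullet> z) ^ k + g z)"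
  shows "P f"
proof -
  obtain xs where xs: "f = (\<lambda>z. \<Sum>(c, a, k)\<leftarrow>xs. c * (a \<bullet> z) ^ k)" using assms(1) unfolding pow_sum_def ..
  have "P (\<lambda>z. \<Sum>(c, a, k)\<leftarrow>xs. c * (a \<bullet> z) ^ k)"
  proof (induction xs)
    case (Cons x xs)
    obtain c a k where x: "x = (c, a, k)" by (cases x)
    have "pow_sum (\<lambda>z. \<Sum>(c, a, k)\<leftarrow>xs. c * (a \<bullet> z) ^ k)" unfolding pow_sum_def by blast
    from assms(3)[OF this Cons] show ?case by (simp add: x)
  qed (simp add: assms(2))
  then show ?thesis by (simp add: xs)
qed

lemma pow_sum_cmult: "pow_sum f \<Longrightarrow> pow_sum (\<lambda>z. d * f z)"
proof (induction rule: pow_sum_induct)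
  case (add c a k g)
  from pow_sum_add[OF pow_sum_power[of "d * c" a k] add(2)] show ?case by (simp add: algebra_simps)
qed (use pow_sum_const[of 0] in simp)

lemma pow_sum_sum:
  "finite I \<Longrightarrow> (\<And>i. i \<in> I \<Longrightarrow> pow_sum (f i)) \<Longrightarrow> pow_sum (\<lambda>z. \<Sum>i\<in>I. f i z)"
  by (induction I rule: finite_induct) (auto intro: pow_sum_const pow_sum_add)

text \<open>Coefficients of a polynomial in \<open>s\<close> are linear combinations of its values.
  Eliminating the top degree repeatedly replaces the inversion of a Vandermonde matrix.\<close>

lemma pow_sum_coeff:
  assumes "\<And>s :: real. pow_sum (\<lambda>z. \<Sum>j\<le>n. s ^ j * w j z)" "j \<le> n"
  shows "pow_sum (w j)"
  using assms
proof (induction n arbitrary: w j)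
  case 0
  from 0(1)[of 0] 0(2) show ?case by simp
next
  case (Suc n)
  \<comment> \<open>with \<open>g s\<close> the given sum, \<open>2 ^ Suc n * g s - g (2 * s)\<close> has no term of degree \<open>Suc n\<close> in \<open>s\<close>\<close>
  have low: "pow_sum (w i)" if "i \<le> n" for i
  proof -
    have "pow_sum (\<lambda>z. \<Sum>j\<le>n. s ^ j * ((2 ^ Suc n - 2 ^ j) * w j z))" for s
    proof -
      have "(\<lambda>z. 2 ^ Suc n * (\<Sum>j\<le>Suc n. s ^ j * w j z) + (- 1) * (\<Sum>j\<le>Suc n. (2 * s) ^ j * w j z)) =
        (\<lambda>z. \<Sum>j\<le>n. s ^ j * ((2 ^ Suc n - 2 ^ j) * w j z))"
        by (simp add: algebra_simps sum_distrib_left sum_subtractf sum_negf power_mult_distrib)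
      then show ?thesis
        using pow_sum_add[OF pow_sum_cmult[OF Suc.prems(1)[of s]] pow_sum_cmult[OF Suc.prems(1)[of "2 * s"]], of "2 ^ Suc n" "-1"]
        by simp
    qed
    from Suc.IH[OF this that] have "pow_sum (\<lambda>z. (2 ^ Suc n - 2 ^ i) * w i z)" .
    from pow_sum_cmult[OF this, of "1 / (2 ^ Suc n - 2 ^ i)"]
    have "pow_sum (\<lambda>z. (1 / (2 ^ Suc n - 2 ^ i)) * ((2 ^ Suc n - 2 ^ i) * w i z))" .
    moreover have "(2 :: real) ^ Suc n - 2 ^ i \<noteq> 0"
      using that power_strict_increasing[of i "Suc n" "2 :: real"] by simp
    ultimately show ?thesis by simp
  qed
  show ?case
  proof (cases "j \<le> n")
    case False
    then have j: "j = Suc n" using Suc.prems(2) by simp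
    have "pow_sum (\<lambda>z. (\<Sum>j\<le>Suc n. 1 ^ j * w j z) + (- 1) * (\<Sum>j\<le>n. w j z))"
      using low by (intro pow_sum_add pow_sum_cmult Suc.prems(1) pow_sum_sum) auto
    then show ?thesis by (simp add: j)
  qed (rule low)
qed

text \<open>Polarization: up to a nonzero binomial coefficient, the product is the coefficient of
  \<open>s ^ j\<close> in the power
  \<open>((a + s *\<^sub>R b) \<bullet> z) ^ (i + j)\<close>.\<close>

lemma pow_sum_power_mult_power: "pow_sum (\<lambda>z. (a \<bullet> z) ^ i * (b \<bullet> z) ^ j)"
proof -
  have "pow_sum (\<lambda>z. \<Sum>l\<le>i + j. s ^ l * (real ((i + j) choose l) * (b \<bullet> z) ^ l * (a \<bullet> z) ^ (i + j - l)))" for s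
  proof -
    have "(\<lambda>z. 1 * ((a + s *\<^sub>R b) \<bullet> z) ^ (i + j)) =
      (\<lambda>z. \<Sum>l\<le>i + j. s ^ l * (real ((i + j) choose l) * (b \<bullet> z) ^ l * (a \<bullet> z) ^ (i + j - l)))"
    proof
      fix z
      have "1 * ((a + s *\<^sub>R b) \<bullet> z) ^ (i + j) = (s * (b \<bullet> z) + a \<bullet> z) ^ (i + j)"
        by (simp add: inner_add_left add.commute)
      also have "\<dots> = (\<Sum>l\<le>i + j. s ^ l * (real ((i + j) choose l) * (b \<bullet> z) ^ l * (a \<bullet> z) ^ (i + j - l)))"
        unfolding binomial_ring by (intro sum.cong) (simp_all add: power_mult_distrib)
      finally show "1 * ((a + s *\<^sub>R b) \<bullet> z) ^ (i + j) =
        (\<Sum>l\<le>i + j. s ^ l * (real ((i + j) choose l) * (b \<bullet> z) ^ l * (a \<bullet> z) ^ (i + j - l)))" .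
    qed
    with pow_sum_power[of 1 "a + s *\<^sub>R b" "i + j"] show ?thesis by simp
  qed
  from pow_sum_coeff[OF this, of j]
  have "pow_sum (\<lambda>z. real ((i + j) choose j) * (b \<bullet> z) ^ j * (a \<bullet> z) ^ i)" by simp
  from pow_sum_cmult[OF this, of "1 / real ((i + j) choose j)"] show ?thesis
    by (simp add: mult.commute)
qed

lemma pow_sum_mult:
  assumes "pow_sum f" "pow_sum g" shows "pow_sum (\<lambda>z. f z * g z)"
  using assms(1)
proof (induction rule: pow_sum_induct)
  case (add c a k f)
  from assms(2) have "pow_sum (\<lambda>z. c * (a \<bullet> z) ^ k * g z)"
  proof (induction rule: pow_sum_induct)
    case (add d b l g)
    from pow_sum_add[OF pow_sum_cmult[OF pow_sum_power_mult_power[of a k b l], of "c * d"] add(2)]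
    show ?case by (simp add: algebra_simps)
  qed (use pow_sum_const[of 0] in simp)
  from pow_sum_add[OF this add(2)] show ?case by (simp add: algebra_simps)
qed (use pow_sum_const[of 0] in simp)

lemma pow_sum_real_polynomial_function:
  fixes p :: "'a::euclidean_space \<Rightarrow> real"
  assumes "real_polynomial_function p" shows "pow_sum (\<lambda>z. p (w + z))"
  using assms
proof (induction rule: real_polynomial_function.induct)
  case (linear f)
  then have f: "linear f" by (rule bounded_linear.linear)
  have "f (w + z) = f w + 1 * ((\<Sum>b\<in>Basis. f b *\<^sub>R b) \<bullet> z) ^ 1" for z
  proof -
    have "f z = f (\<Sum>b\<in>Basis. (z \<bullet> b) *\<^sub>R b)" by (simp add: euclidean_representation)
    also have "\<dots> = (\<Sum>b\<in>Basis. f b * (b \<bullet> z))"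
      unfolding linear_sum[OF f] linear_scale[OF f] by (intro sum.cong) (simp_all add: inner_commute)
    also have "\<dots> = (\<Sum>b\<in>Basis. f b *\<^sub>R b) \<bullet> z"
      by (simp add: inner_sum_left)
    finally show ?thesis by (simp add: linear_add[OF f])
  qed
  moreover have "pow_sum (\<lambda>z. f w + 1 * ((\<Sum>b\<in>Basis. f b *\<^sub>R b) \<bullet> z) ^ 1)"
    by (intro pow_sum_add pow_sum_const pow_sum_power)
  ultimately show ?case by simp
qed (auto intro: pow_sum_const pow_sum_add pow_sum_mult)

text \<open>Near \<open>w\<close> the positive definite quadratic part can spare the small multiple of \<open>(a i \<bullet> z)\<^sup>2\<close> which turns
  each higher order term \<open>c i * (a i \<bullet> z) ^ k i\<close> into a function with semidefinite representable
  epigraph.\<close>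

lemma sdp_sublevel_local:
  fixes p :: "'a::euclidean_space \<Rightarrow> real"
  assumes p: "real_polynomial_function p"
    and pd: "\<And>z. z \<noteq> 0 \<Longrightarrow> \<exists>p' q. q > 0 \<and> (\<forall>t. ((\<lambda>t. p (w + t *\<^sub>R z)) has_real_derivative p' t) (at t)) \<and>
      (p' has_real_derivative q) (at 0)"
  shows "\<exists>r>0. sdp {x \<in> cball w r. p x \<le> 0}"
proof -
  obtain xs where xs: "\<And>z. p (w + z) = (\<Sum>(c, a, k)\<leftarrow>xs. c * (a \<bullet> z) ^ k)"
    using pow_sum_real_polynomial_function[OF p, of w] unfolding pow_sum_def by metis
  define I where "I = {..<length xs}"
  define c where "c i = fst (xs ! i)" for i
  define a where "a i = fst (snd (xs ! i))" for i
  define k where "k i = snd (snd (xs ! i))" for i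
  have p_eq: "p (w + z) = (\<Sum>i\<in>I. c i * (a i \<bullet> z) ^ k i)" for z
    unfolding xs sum_list_sum_nth by (simp add: I_def c_def a_def k_def case_prod_unfold atLeast0LessThan)
  have "finite I" by (simp add: I_def)
  define Q where "Q z = (\<Sum>i\<in>I. if k i = 2 then c i * (a i \<bullet> z)\<^sup>2 else 0)" for z
  have Q_pos: "Q z > 0" if z: "z \<noteq> 0" for z
  proof -
    obtain p' q where q: "q > 0" and d1: "\<And>t. ((\<lambda>t. p (w + t *\<^sub>R z)) has_real_derivative p' t) (at t)"
      and d2: "(p' has_real_derivative q) (at 0)" using pd[OF z] by blast
    have line: "(\<lambda>t. p (w + t *\<^sub>R z)) = (\<lambda>t. \<Sum>i\<in>I. c i * (a i \<bullet> z) ^ k i * t ^ k i)"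
      by (simp add: p_eq power_mult_distrib algebra_simps)
    have "((\<lambda>t. \<Sum>i\<in>I. c i * (a i \<bullet> z) ^ k i * t ^ k i) has_real_derivative
        (\<Sum>i\<in>I. c i * (a i \<bullet> z) ^ k i * (real (k i) * t ^ (k i - 1)))) (at t)" for t
      by (intro DERIV_sum) (auto intro!: derivative_eq_intros)
    then have p': "p' = (\<lambda>t. \<Sum>i\<in>I. c i * (a i \<bullet> z) ^ k i * (real (k i) * t ^ (k i - 1)))"
      using d1 unfolding line by (intro ext) (rule DERIV_unique)
    have "((\<lambda>t. \<Sum>i\<in>I. c i * (a i \<bullet> z) ^ k i * (real (k i) * t ^ (k i - 1))) has_real_derivative
        (\<Sum>i\<in>I. c i * (a i \<bullet> z) ^ k i * (real (k i) * (real (k i - 1) * 0 ^ (k i - 1 - 1))))) (at 0)"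
      by (intro DERIV_sum) (auto intro!: derivative_eq_intros)
    with d2 have "q = (\<Sum>i\<in>I. c i * (a i \<bullet> z) ^ k i * (real (k i) * (real (k i - 1) * 0 ^ (k i - 1 - 1))))"
      unfolding p' by (rule DERIV_unique)
    also have "\<dots> = 2 * Q z"
      unfolding Q_def sum_distrib_left
    proof (intro sum.cong refl)
      fix i
      \<comment> \<open>At \<open>t = 0\<close> only exponent 2 survives. Natural subtraction
        truncates, so \<open>0 ^ (k i - 1 - 1)\<close> is 1 for exponents 0 and 1 as well, but there
        the factor \<open>k i * (k i - 1)\<close> vanishes.\<close>
      consider "k i = 0" | "k i = 1" | "k i = 2" | "k i > 2" by linarith
      then show "c i * (a i \<bullet> z) ^ k i * (real (k i) * (real (k i - 1) * 0 ^ (k i - 1 - 1))) =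
          2 * (if k i = 2 then c i * (a i \<bullet> z)\<^sup>2 else 0)"
        by cases auto
    qed
    finally show ?thesis using q by simp
  qed
  have Q_scale: "Q (s *\<^sub>R z) = s\<^sup>2 * Q z" for s z
    unfolding Q_def sum_distrib_left by (intro sum.cong) (auto simp: power_mult_distrib)
  have "continuous_on (sphere 0 1) Q"
    unfolding Q_def
  proof (intro continuous_on_sum)
    show "continuous_on (sphere 0 1) (\<lambda>z. if k i = 2 then c i * (a i \<bullet> z)\<^sup>2 else 0)" for i
      by (cases "k i = 2") (auto intro!: continuous_intros)
  qed
  then obtain z0 where z0: "norm z0 = 1" "\<And>z. norm z = 1 \<Longrightarrow> Q z0 \<le> Q z"
    using continuous_attains_inf[of "sphere (0 :: 'a) 1" Q] by auto
  define \<eta> where "\<eta> = Q z0"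
  have "\<eta> > 0" using z0(1) Q_pos[of z0] by (cases "z0 = 0") (auto simp: \<eta>_def)
  have Q_ge: "\<eta> * (norm z)\<^sup>2 \<le> Q z" for z
  proof (cases "z = 0")
    case False
    have "\<eta> \<le> Q ((1 / norm z) *\<^sub>R z)" unfolding \<eta>_def using False by (intro z0(2)) simp
    also have "\<dots> = Q z / (norm z)\<^sup>2" unfolding Q_scale by (simp add: power_divide)
    finally show ?thesis using False by (simp add: field_simps)
  next
    case True
    then show ?thesis using Q_scale[of 0 0] by simp
  qed
  \<comment> \<open>All squares to be spared on a ball of radius \<open>r \<le> 1\<close> add up to
    at most \<open>r * K * (norm z)\<^sup>2\<close>. The radius chosen next makes this at most
    \<open>\<eta> * (norm z)\<^sup>2\<close>, which is below \<open>Q z\<close>; the denominator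
    \<open>K + 1\<close> cannot vanish.\<close>
  define K where "K = (\<Sum>i\<in>I. \<bar>c i\<bar> * (real (k i))\<^sup>2 * (norm (a i) + 1) ^ k i * (norm (a i))\<^sup>2)"
  have "K \<ge> 0" unfolding K_def by (intro sum_nonneg) auto
  define r where "r = min 1 (\<eta> / (K + 1))"
  have r: "r > 0" "r \<le> 1" "r * K \<le> \<eta>"
  proof -
    show "r > 0" "r \<le> 1" using \<open>\<eta> > 0\<close> \<open>K \<ge> 0\<close> by (auto simp: r_def)
    have "r * K \<le> \<eta> / (K + 1) * (K + 1)"
      using \<open>\<eta> > 0\<close> \<open>K \<ge> 0\<close> \<open>r > 0\<close> by (intro mult_mono) (auto simp: r_def)
    then show "r * K \<le> \<eta>" using \<open>K \<ge> 0\<close> by simp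
  qed
  \<comment> \<open>A bound for \<open>\<bar>a i \<bullet> z\<bar>\<close> on the ball of radius
    \<open>r\<close>, kept positive by the added 1 even if \<open>a i = 0\<close>.\<close>
  define \<rho> where "\<rho> i = r * (norm (a i) + 1)" for i
  have \<rho>: "\<rho> i > 0" for i using r by (simp add: \<rho>_def add_nonneg_pos)
  define \<gamma> where "\<gamma> i = (if k i \<ge> 3 then \<bar>c i\<bar> * (real (k i))\<^sup>2 * \<rho> i ^ (k i - 2) else 0)" for i
  \<comment> \<open>The polarized quadratic part after the squares with weights
    \<open>\<gamma> i\<close> have been lent to the higher powers.\<close>
  define b where "b x y = (\<Sum>i\<in>I. ((if k i = 2 then c i else 0) - \<gamma> i) * (a i \<bullet> x) * (a i \<bullet> y))" for x y
  have \<gamma>_le: "\<gamma> i * (a i \<bullet> z)\<^sup>2 \<le> r * (\<bar>c i\<bar> * (real (k i))\<^sup>2 * (norm (a i) + 1) ^ k i * (norm (a i))\<^sup>2) * (norm z)\<^sup>2" for i z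
  proof (cases "k i \<ge> 3")
    case True
    \<comment> \<open>The exponent \<open>k i - 2\<close> is at least 1 and
      \<open>r \<le> 1\<close>, so a full factor \<open>r\<close> can be extracted.\<close>
    have "r ^ (k i - 2) \<le> r ^ 1" using True r by (intro power_decreasing) auto
    moreover have "(norm (a i) + 1) ^ (k i - 2) \<le> (norm (a i) + 1) ^ k i" by (intro power_increasing) auto
    ultimately have "\<rho> i ^ (k i - 2) \<le> r * (norm (a i) + 1) ^ k i"
      unfolding \<rho>_def power_mult_distrib using r by (intro mult_mono) auto
    moreover have "(a i \<bullet> z)\<^sup>2 \<le> (norm (a i))\<^sup>2 * (norm z)\<^sup>2"
      using power_mono[OF Cauchy_Schwarz_ineq2[of "a i" z], of 2] by (simp add: power_mult_distrib)
    ultimately have "\<bar>c i\<bar> * (real (k i))\<^sup>2 * \<rho> i ^ (k i - 2) * (a i \<bullet> z)\<^sup>2 \<le>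
        \<bar>c i\<bar> * (real (k i))\<^sup>2 * (r * (norm (a i) + 1) ^ k i) * ((norm (a i))\<^sup>2 * (norm z)\<^sup>2)"
      using r \<rho>[of i] by (intro mult_mono mult_nonneg_nonneg order_refl) (auto intro!: mult_nonneg_nonneg)
    also have "\<dots> = r * (\<bar>c i\<bar> * (real (k i))\<^sup>2 * (norm (a i) + 1) ^ k i * (norm (a i))\<^sup>2) * (norm z)\<^sup>2"
      by (simp only: mult_ac)
    finally show ?thesis using True by (simp only: \<gamma>_def if_True)
  next
    case False
    have "0 \<le> r * (\<bar>c i\<bar> * (real (k i))\<^sup>2 * (norm (a i) + 1) ^ k i * (norm (a i))\<^sup>2) * (norm z)\<^sup>2"
      using r by (intro mult_nonneg_nonneg) auto
    then show ?thesis using False by (simp only: \<gamma>_def if_False mult_zero_left)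
  qed
  have b_nonneg: "b z z \<ge> 0" for z
  proof -
    have "(\<Sum>i\<in>I. \<gamma> i * (a i \<bullet> z)\<^sup>2) \<le> r * K * (norm z)\<^sup>2"
      unfolding K_def sum_distrib_left sum_distrib_right by (intro sum_mono \<gamma>_le)
    also have "\<dots> \<le> \<eta> * (norm z)\<^sup>2" using r by (intro mult_right_mono) auto
    also have "\<dots> \<le> Q z" by (rule Q_ge)
    finally have "0 \<le> Q z - (\<Sum>i\<in>I. \<gamma> i * (a i \<bullet> z)\<^sup>2)" by simp
    also have "\<dots> = b z z"
      unfolding Q_def b_def sum_subtractf[symmetric]
      by (intro sum.cong) (auto simp: power2_eq_square algebra_simps)
    finally show ?thesis .
  qed
  have "bilinear b"
    unfolding bilinear_def b_def
    by (intro conjI allI linearI)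
      (simp_all add: inner_add_left inner_add_right sum.distrib[symmetric] sum_distrib_left distrib_left distrib_right mult_ac)
  then have sdp_b: "sdp (epi_on UNIV (\<lambda>z. b z z))"
    using b_nonneg by (intro sdp_epi_on_psd_bilinear[of b]) (simp_all add: b_def mult_ac)
  define low where "low i z = (if k i \<le> 1 then c i * (a i \<bullet> z) ^ k i else 0)" for i z
  define high where "high i z = (if k i \<ge> 3 then c i * (a i \<bullet> z) ^ k i + \<gamma> i * (a i \<bullet> z)\<^sup>2 else 0)" for i z
  have restrict: "sdp (epi_on UNIV \<phi>) \<Longrightarrow> sdp (epi_on (cball 0 r) \<phi>)" for \<phi> :: "'a \<Rightarrow> real"
    by (rule sdp_epi_on_subset[OF sdp_cball_0]) auto
  have zero: "sdp (epi_on (cball 0 r) (\<lambda>z :: 'a. 0))"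
    using restrict[OF sdp_epi_on_affine[OF linear_zero, of 0]] by simp
  have sdp_low: "sdp (epi_on (cball 0 r) (low i))" for i
  proof -
    consider "k i = 0" | "k i = 1" | "k i > 1" by linarith
    then have "low i = (\<lambda>z. (if k i = 0 then c i else 0) + (if k i = 1 then c i else 0) * (a i \<bullet> z))"
      by cases (auto simp: low_def)
    moreover have "linear (\<lambda>z. (if k i = 1 then c i else 0) * (a i \<bullet> z))"
      by (rule linearI) (auto simp: inner_add_right algebra_simps)
    ultimately show ?thesis
      using restrict[OF sdp_epi_on_affine[of "\<lambda>z. (if k i = 1 then c i else 0) * (a i \<bullet> z)"]] by simp
  qed
  have sdp_high: "sdp (epi_on (cball 0 r) (high i))" for i
  proof (cases "k i \<ge> 3")
    case True
    have "high i = (\<lambda>z. c i * (a i \<bullet> z) ^ k i + \<bar>c i\<bar> * (real (k i))\<^sup>2 * \<rho> i ^ (k i - 2) * (a i \<bullet> z)\<^sup>2)"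
      using True by (simp add: high_def \<gamma>_def fun_eq_iff)
    then have "sdp (epi_on {z. \<bar>a i \<bullet> z\<bar> \<le> \<rho> i} (high i))"
      using sdp_epi_on_inner_power[of "k i" "\<rho> i" "a i" "c i"] True \<rho> by simp
    moreover have "\<bar>a i \<bullet> z\<bar> \<le> \<rho> i" if "z \<in> cball 0 r" for z
    proof -
      have "\<bar>a i \<bullet> z\<bar> \<le> norm (a i) * r"
        using Cauchy_Schwarz_ineq2[of "a i" z] mult_left_mono[of "norm z" r "norm (a i)"] that by auto
      then show ?thesis using r by (simp add: \<rho>_def algebra_simps)
    qed
    ultimately show ?thesis by (intro sdp_epi_on_subset[OF sdp_cball_0]) auto
  next
    case False
    then have "high i = (\<lambda>z. 0)" by (simp add: high_def fun_eq_iff)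
    then show ?thesis using zero by simp
  qed
  \<comment> \<open>Affine terms, the reduced quadratic form and the strengthened higher powers add
    up to \<open>p (w + z)\<close>, since the lent squares cancel.\<close>
  have "sdp (epi_on (cball 0 r) (\<lambda>z. (\<Sum>i\<in>I. low i z) + b z z + (\<Sum>i\<in>I. high i z)))"
    using \<open>finite I\<close> by (intro sdp_epi_on_add sdp_epi_on_sum restrict[OF sdp_b] sdp_low sdp_high zero) auto
  moreover have "(\<Sum>i\<in>I. low i z) + b z z + (\<Sum>i\<in>I. high i z) = p (w + z)" for z
    unfolding p_eq b_def sum.distrib[symmetric]
  proof (intro sum.cong refl)
    fix i
    consider "k i \<le> 1" | "k i = 2" | "k i > 2" by linarith
    then show "low i z + ((if k i = 2 then c i else 0) - \<gamma> i) * (a i \<bullet> z) * (a i \<bullet> z) + high i z = c i * (a i \<bullet> z) ^ k i"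
      by cases (auto simp: low_def high_def \<gamma>_def power2_eq_square algebra_simps)
  qed
  ultimately have "sdp (epi_on (cball 0 r) (\<lambda>z. p (w + z)))" by simp
  then have "sdp {z \<in> cball 0 r. p (w + z) \<le> 0}" by (rule sdp_sublevel)
  from sdp_vimage[OF this linear_ident, of "- w"]
  have "sdp {x \<in> cball w r. p x \<le> 0}"
    by (rule back_subst[of sdp]) (auto simp: dist_norm norm_minus_commute)
  with r show ?thesis by blast
qed

section \<open>Strict convexity and supporting hyperplanes\<close>

lemma partial_deriv_eq: "(f has_derivative f') (at x) \<Longrightarrow> partial_deriv i f x = f' (axis i 1)"
  by (simp add: partial_deriv_def frechet_derivative_at[symmetric])

lemma has_derivative_real_polynomial_function:
  fixes f :: "real ^ 'n \<Rightarrow> real"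
  shows "real_polynomial_function f \<Longrightarrow> (f has_derivative frechet_derivative f (at x)) (at x)"
  by (simp add: differentiable_at_real_polynomial_function frechet_derivative_works[symmetric])

lemma partial_deriv_add:
  fixes f g :: "real ^ 'n \<Rightarrow> real"
  assumes "real_polynomial_function f" "real_polynomial_function g"
  shows "partial_deriv i (\<lambda>x. f x + g x) = (\<lambda>x. partial_deriv i f x + partial_deriv i g x)"
proof
  fix x
  show "partial_deriv i (\<lambda>x. f x + g x) x = partial_deriv i f x + partial_deriv i g x"
    using partial_deriv_eq[OF has_derivative_add[OF assms[THEN has_derivative_real_polynomial_function]]]
    by (simp add: partial_deriv_def)
qed

lemma partial_deriv_mult:
  fixes f g :: "real ^ 'n \<Rightarrow> real"
  assumes "real_polynomial_function f" "real_polynomial_function g"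
  shows "partial_deriv i (\<lambda>x. f x * g x) = (\<lambda>x. f x * partial_deriv i g x + partial_deriv i f x * g x)"
proof
  fix x
  show "partial_deriv i (\<lambda>x. f x * g x) x = f x * partial_deriv i g x + partial_deriv i f x * g x"
    using partial_deriv_eq[OF has_derivative_mult[OF assms[THEN has_derivative_real_polynomial_function]]]
    by (simp add: partial_deriv_def)
qed

lemma partial_deriv_const: "partial_deriv i (\<lambda>x. c) = (\<lambda>x. 0)"
  by (simp add: partial_deriv_def fun_eq_iff)

lemma partial_deriv_sum:
  fixes f :: "'i \<Rightarrow> real ^ 'n \<Rightarrow> real"
  assumes "finite J" "\<And>j. j \<in> J \<Longrightarrow> real_polynomial_function (f j)"
  shows "partial_deriv i (\<lambda>x. \<Sum>j\<in>J. c j * f j x) = (\<lambda>x. \<Sum>j\<in>J. c j * partial_deriv i (f j) x)"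
  using assms
proof (induction J rule: finite_induct)
  case (insert j J)
  then have poly: "real_polynomial_function (\<lambda>x. c j * f j x)" "real_polynomial_function (\<lambda>x. \<Sum>j\<in>J. c j * f j x)"
    by (auto intro!: real_polynomial_function_sum real_polynomial_function.intros(2,4))
  have "partial_deriv i (\<lambda>x. c j * f j x) = (\<lambda>x. c j * partial_deriv i (f j) x)"
    using partial_deriv_mult[of "\<lambda>x. c j" "f j"] insert.prems[of j] by (auto simp: partial_deriv_const)
  with insert poly show ?case by (simp add: partial_deriv_add[OF poly])
qed (simp add: partial_deriv_const)

lemma real_polynomial_function_partial_deriv:
  fixes f :: "real ^ 'n \<Rightarrow> real"
  assumes "real_polynomial_function f" shows "real_polynomial_function (partial_deriv i f)"
  using assms
proof (induction rule: real_polynomial_function.induct)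
  case (linear f)
  then have "partial_deriv i f = (\<lambda>x. f (axis i 1))"
    by (intro ext partial_deriv_eq bounded_linear_imp_has_derivative)
  then show ?case by auto
qed (auto simp: partial_deriv_const partial_deriv_add partial_deriv_mult)

lemma gradient_line:
  fixes f :: "real ^ 'n \<Rightarrow> real"
  assumes "real_polynomial_function f"
  shows "((\<lambda>t. f (x + t *\<^sub>R z)) has_real_derivative gradient f (x + t *\<^sub>R z) \<bullet> z) (at t)"
proof -
  let ?y = "x + t *\<^sub>R z"
  have d: "(f has_derivative frechet_derivative f (at ?y)) (at ?y)"
    by (rule has_derivative_real_polynomial_function[OF assms])
  then have lin: "linear (frechet_derivative f (at ?y))" by (rule has_derivative_linear)
  have "frechet_derivative f (at ?y) z = frechet_derivative f (at ?y) (\<Sum>i\<in>UNIV. z $ i *\<^sub>R axis i 1)"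
    using basis_expansion[of z] by (simp add: scalar_mult_eq_scaleR)
  also have "\<dots> = gradient f ?y \<bullet> z"
    by (simp add: linear_sum[OF lin] linear_scale[OF lin] gradient_def partial_deriv_def inner_vec_def mult.commute)
  finally have *: "frechet_derivative f (at ?y) z = gradient f ?y \<bullet> z" .
  have "((\<lambda>t. f (x + t *\<^sub>R z)) has_derivative (\<lambda>s. frechet_derivative f (at ?y) (s *\<^sub>R z))) (at t)"
    by (rule has_derivative_compose[where g = f and f = "\<lambda>t. x + t *\<^sub>R z", OF _ d]) (auto intro!: derivative_eq_intros)
  then show ?thesis
    by (simp add: has_field_derivative_def linear_scale[OF lin] * mult_commute_abs)
qed

lemma hessian_line:
  fixes f :: "real ^ 'n \<Rightarrow> real"
  assumes "real_polynomial_function f"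
  shows "((\<lambda>t. gradient f (x + t *\<^sub>R z) \<bullet> z) has_real_derivative z \<bullet> (hessian f (x + t *\<^sub>R z) *v z)) (at t)"
proof -
  have "((\<lambda>t. \<Sum>j\<in>UNIV. partial_deriv j f (x + t *\<^sub>R z) * z $ j) has_real_derivative
      (\<Sum>j\<in>UNIV. gradient (partial_deriv j f) (x + t *\<^sub>R z) \<bullet> z * z $ j)) (at t)"
    by (intro DERIV_sum DERIV_cmult_right gradient_line real_polynomial_function_partial_deriv assms)
  moreover have "(\<Sum>j\<in>UNIV. gradient (partial_deriv j f) y \<bullet> z * z $ j) = z \<bullet> (hessian f y *v z)" for y
    unfolding inner_vec_def matrix_vector_mult_def gradient_def hessian_def
    by (simp add: sum_distrib_left sum_distrib_right) (subst sum.swap, simp add: mult_ac)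
  ultimately show ?thesis by (simp add: gradient_def inner_vec_def)
qed

section \<open>Strict convexity from positive definite Hessians\<close>

lemma second_derivative_pos_imp_strict:
  fixes g :: "real \<Rightarrow> real"
  assumes d1: "\<And>t. (g has_real_derivative g' t) (at t)" and d2: "\<And>t. (g' has_real_derivative g'' t) (at t)"
    and pos: "\<And>t. 0 \<le> t \<Longrightarrow> t \<le> 1 \<Longrightarrow> g'' t > 0"
  shows "g 1 > g 0 + g' 0" and "0 < t \<Longrightarrow> t < 1 \<Longrightarrow> g t < (1 - t) * g 0 + t * g 1"
proof -
  have mono: "g' x < g' y" if "0 \<le> x" "x < y" "y \<le> 1" for x y
  proof (rule DERIV_pos_imp_increasing[OF that(2)])
    fix t assume "x \<le> t" "t \<le> y"
    with that show "\<exists>y. (g' has_real_derivative y) (at t) \<and> 0 < y"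
      by (intro exI[of _ "g'' t"] conjI d2 pos) auto
  qed
  show "g 1 > g 0 + g' 0"
  proof -
    obtain \<xi> where "0 < \<xi>" "\<xi> < 1" "g 1 - g 0 = (1 - 0) * g' \<xi>"
      using MVT2[of 0 1 g g'] d1 by (metis zero_less_one)
    with mono[of 0 \<xi>] show ?thesis by simp
  qed
  show "g t < (1 - t) * g 0 + t * g 1" if t: "0 < t" "t < 1"
  proof -
    \<comment> \<open>The mean value theorem on both sides of \<open>t\<close> compares the two
      slopes, and \<open>g'\<close> is strictly increasing.\<close>
    obtain \<xi> where 1: "0 < \<xi>" "\<xi> < t" "g t - g 0 = (t - 0) * g' \<xi>" using MVT2[of 0 t g g'] d1 t by metis
    obtain \<zeta> where 2: "t < \<zeta>" "\<zeta> < 1" "g 1 - g t = (1 - t) * g' \<zeta>" using MVT2[of t 1 g g'] d1 t by metis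
    have "t * (1 - t) * g' \<xi> < t * (1 - t) * g' \<zeta>"
      using t 1 2 by (intro mult_strict_left_mono mono) auto
    moreover have "(1 - t) * (g t - g 0) = t * (1 - t) * g' \<xi>" "t * (g 1 - g t) = t * (1 - t) * g' \<zeta>"
      unfolding 1(3) 2(3) by simp_all
    ultimately have "(1 - t) * (g t - g 0) < t * (g 1 - g t)" by (simp only:)
    then show ?thesis by (simp add: algebra_simps)
  qed
qed

definition hessian_pos_on :: "(real ^ 'n::finite) set \<Rightarrow> (real ^ 'n \<Rightarrow> real) \<Rightarrow> bool" where
  "hessian_pos_on B F \<longleftrightarrow> real_polynomial_function F \<and> (\<forall>x\<in>B. \<forall>z. z \<noteq> 0 \<longrightarrow> z \<bullet> (hessian F x *v z) > 0)"

lemma hessian_pos_on_strict: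
  assumes "hessian_pos_on B F" "convex B" "x \<in> B" "y \<in> B" "x \<noteq> y"
  shows "F y > F x + gradient F x \<bullet> (y - x)"
    and "0 < t \<Longrightarrow> t < 1 \<Longrightarrow> F ((1 - t) *\<^sub>R x + t *\<^sub>R y) < (1 - t) * F x + t * F y"
proof -
  have F: "real_polynomial_function F" using assms(1) by (simp add: hessian_pos_on_def)
  have line: "x + t *\<^sub>R (y - x) = (1 - t) *\<^sub>R x + t *\<^sub>R y" for t by (simp add: algebra_simps)
  have pos: "(y - x) \<bullet> (hessian F (x + t *\<^sub>R (y - x)) *v (y - x)) > 0" if "0 \<le> t" "t \<le> 1" for t
  proof -
    have "x + t *\<^sub>R (y - x) \<in> B" unfolding line using assms(2-4) that by (intro convexD) auto
    with assms(1,5) show ?thesis by (auto simp: hessian_pos_on_def)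
  qed
  note strict = second_derivative_pos_imp_strict[OF gradient_line[OF F, of x "y - x"] hessian_line[OF F, of x "y - x"] pos]
  show "F y > F x + gradient F x \<bullet> (y - x)" using strict(1) by simp
  show "F ((1 - t) *\<^sub>R x + t *\<^sub>R y) < (1 - t) * F x + t * F y" if "0 < t" "t < 1"
    using strict(2)[OF _ _ that] unfolding line by simp
qed

lemma convex_hessian_pos_on_sublevel:
  assumes "hessian_pos_on B F" "convex B" shows "convex {x \<in> B. F x \<le> 0}"
proof (subst convex_alt, intro ballI allI impI)
  fix x y t assume *: "x \<in> {x \<in> B. F x \<le> 0}" "y \<in> {x \<in> B. F x \<le> 0}" "0 \<le> t \<and> t \<le> (1 :: real)"
  have "F ((1 - t) *\<^sub>R x + t *\<^sub>R y) \<le> 0"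
  proof (cases "x = y \<or> t = 0 \<or> t = 1")
    case True
    then have "(1 - t) *\<^sub>R x + t *\<^sub>R y \<in> {x, y}" by (auto simp flip: scaleR_add_left)
    with * show ?thesis by auto
  next
    case False
    then have "F ((1 - t) *\<^sub>R x + t *\<^sub>R y) < (1 - t) * F x + t * F y"
      using * by (intro hessian_pos_on_strict(2)[OF assms]) auto
    also have "\<dots> \<le> 0" using * by (intro add_nonpos_nonpos mult_nonneg_nonpos) auto
    finally show ?thesis by simp
  qed
  moreover have "(1 - t) *\<^sub>R x + t *\<^sub>R y \<in> B" using * assms(2) by (intro convexD) auto
  ultimately show "(1 - t) *\<^sub>R x + t *\<^sub>R y \<in> {x \<in> B. F x \<le> 0}" by simp
qed

lemma sdp_hessian_pos_on_local:
  assumes "hessian_pos_on B F" "w \<in> B"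
  shows "\<exists>r>0. sdp {x \<in> cball w r. F x \<le> 0}"
proof (rule sdp_sublevel_local)
  show F: "real_polynomial_function F" using assms(1) by (simp add: hessian_pos_on_def)
  fix z :: "real ^ 'a" assume "z \<noteq> 0"
  then have "z \<bullet> (hessian F w *v z) > 0" using assms by (auto simp: hessian_pos_on_def)
  with gradient_line[OF F, of w z] hessian_line[OF F, of w z 0]
  show "\<exists>p' q. q > 0 \<and> (\<forall>t. ((\<lambda>t. F (w + t *\<^sub>R z)) has_real_derivative p' t) (at t)) \<and>
      (p' has_real_derivative q) (at 0)"
    by (intro exI[of _ "\<lambda>t. gradient F (w + t *\<^sub>R z) \<bullet> z"] exI[of _ "z \<bullet> (hessian F w *v z)"]) simp
qed

section \<open>Supporting hyperplanes and the convex boundary\<close>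

lemma supporting_hyperplane_frontier:
  fixes K :: "'a::euclidean_space set"
  assumes "closed K" "convex K" "b \<in> frontier K"
  shows "\<exists>l. norm l = 1 \<and> (\<forall>y\<in>K. l \<bullet> b \<le> l \<bullet> y)"
proof -
  have bK: "b \<in> K" "b \<notin> interior K" using assms(1,3) by (auto simp: frontier_def)
  have "\<exists>a. a \<noteq> 0 \<and> (\<forall>y\<in>K. a \<bullet> b \<le> a \<bullet> y)"
  \<comment> \<open>A convex set without interior lies in a hyperplane, whose normal supports it at
    each of its points. Otherwise the relative interior is the interior, and \<open>b\<close> is a
    relative boundary point.\<close>
  proof (cases "interior K = {}")
    case True
    obtain a c where a: "a \<noteq> 0" "K \<subseteq> {x. a \<bullet> x = c}"
      using empty_interior_subset_hyperplane[OF assms(2) True] by blast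
    then have "a \<bullet> y = c" if "y \<in> K" for y using that by blast
    with a(1) bK(1) show ?thesis by (intro exI[of _ a]) simp
  next
    case False
    then have "b \<notin> rel_interior K" using bK rel_interior_nonempty_interior by metis
    then obtain a where "a \<noteq> 0" "\<And>y. y \<in> K \<Longrightarrow> a \<bullet> b \<le> a \<bullet> y"
      using supporting_hyperplane_rel_boundary[OF assms(2) bK(1)] by metis
    then show ?thesis by blast
  qed
  then obtain a where a: "a \<noteq> 0" "\<forall>y\<in>K. a \<bullet> b \<le> a \<bullet> y" by blast
  then show ?thesis by (intro exI[of _ "a /\<^sub>R norm a"]) (auto intro!: divide_right_mono simp: divide_inverse_commute mult_left_mono)
qed

text \<open>Intersecting \<open>T\<close> with a closed set makes the convex boundary compact. A
  minimizer of \<open>l\<close> cannot be interior to the hull because moving along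
  \<open>- l\<close> decreases the functional; conversely a frontier point has a supporting
  functional.\<close>

lemma convex_boundary_eq_frontier:
  fixes T :: "(real ^ 'n) set"
  assumes "compact T"
  shows "convex_boundary T = T \<inter> frontier (convex hull T)"
proof -
  let ?K = "convex hull T"
  have K: "closed ?K" "convex ?K" using assms by (auto intro!: compact_imp_closed compact_convex_hull)
  show ?thesis
  proof (intro set_eqI iffI)
    fix u assume "u \<in> convex_boundary T"
    then obtain l where u: "u \<in> T" and l: "norm l = 1" "\<And>x. x \<in> T \<Longrightarrow> l \<bullet> u \<le> l \<bullet> x"
      by (auto simp: convex_boundary_def is_global_minimizer_def)
    have sub: "?K \<subseteq> {x. l \<bullet> x \<ge> l \<bullet> u}"
      using l by (intro hull_minimal convex_halfspace_ge) auto
    have "u \<notin> interior ?K"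
    proof
      assume "u \<in> interior ?K"
      then obtain e where e: "e > 0" "cball u e \<subseteq> ?K" by (auto simp: mem_interior_cball)
      have "u - e *\<^sub>R l \<in> cball u e" using e(1) l(1) by (simp add: dist_norm)
      with e(2) sub have "u - e *\<^sub>R l \<in> {x. l \<bullet> x \<ge> l \<bullet> u}" by blast
      then have "l \<bullet> u \<le> l \<bullet> (u - e *\<^sub>R l)" by simp
      then show False using e(1) l(1) by (simp add: inner_diff_right dot_square_norm)
    qed
    with u K(1) show "u \<in> T \<inter> frontier ?K" by (auto simp: frontier_def hull_inc)
  next
    fix u assume u: "u \<in> T \<inter> frontier ?K"
    then obtain l where "norm l = 1" "\<forall>y\<in>?K. l \<bullet> u \<le> l \<bullet> y"
      using supporting_hyperplane_frontier[OF K] by blast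
    with u show "u \<in> convex_boundary T"
      unfolding convex_boundary_def is_global_minimizer_def by (auto intro: hull_inc)
  qed
qed

text \<open>By Minkowski's theorem the hull is generated by its extreme points; these belong to
  \<open>T\<close> and are not interior to the hull.\<close>

lemma convex_hull_convex_boundary:
  fixes T :: "(real ^ 'n) set"
  assumes "compact T" shows "convex hull (convex_boundary T) = convex hull T"
proof
  show "convex hull (convex_boundary T) \<subseteq> convex hull T"
    by (intro hull_mono) (auto simp: convex_boundary_def)
  have "{x. x extreme_point_of (convex hull T)} \<subseteq> convex_boundary T"
  proof
    fix x assume "x \<in> {x. x extreme_point_of (convex hull T)}"
    then have ext: "x extreme_point_of (convex hull T)" by simp
    have "x \<in> T" "x \<notin> interior (convex hull T)"
      using extreme_point_of_convex_hull[OF ext] extreme_point_not_in_interior[OF ext] .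
    moreover have "x \<in> closure (convex hull T)"
      by (intro subsetD[OF closure_subset] hull_inc calculation(1))
    ultimately show "x \<in> convex_boundary T"
      unfolding convex_boundary_eq_frontier[OF assms] frontier_def by simp
  qed
  then show "convex hull T \<subseteq> convex hull (convex_boundary T)"
    by (subst Krein_Milman_Minkowski[OF compact_convex_hull[OF assms] convex_convex_hull]) (rule hull_mono)
qed

section \<open>The convex hull near a point of the convex boundary\<close>

lemma sdp_cball: "sdp (cball (w :: 'a::euclidean_space) r)"
  using sdp_vimage[OF sdp_cball_0[of r] linear_ident, of "- w"]
  by (rule back_subst[of sdp]) (auto simp: dist_norm norm_minus_commute)

text \<open>Each constraint is representable on some ball around a given point, and the smallest of
  the finitely many radii serves all of them. The set is compact and convex, so the local pieces
  assemble to the set itself.\<close>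

lemma sdp_hessian_pos_on_sublevels:
  assumes "finite I" "\<And>i. i \<in> I \<Longrightarrow> hessian_pos_on (cball u \<delta>) (F i)"
  shows "sdp {x \<in> cball u \<delta>. \<forall>i\<in>I. F i x \<le> 0}" (is "sdp ?K")
proof -
  have K_eq: "?K = cball u \<delta> \<inter> (\<Inter>i\<in>I. {x \<in> cball u \<delta>. F i x \<le> 0})" by auto
  have poly: "real_polynomial_function (F i)" if "i \<in> I" for i
    using assms(2)[OF that] by (simp add: hessian_pos_on_def)
  have "closed {x \<in> cball u \<delta>. F i x \<le> 0}" if "i \<in> I" for i
    using continuous_on_polymonial_function[OF poly[OF that, unfolded real_polynomial_function_eq], of UNIV]
    unfolding Collect_conj_eq Collect_mem_eq by (intro closed_Int closed_cball closed_Collect_le continuous_on_const)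
  then have "compact ?K" unfolding K_eq by (intro compact_Int_closed closed_INT) auto
  have "convex ?K"
    unfolding K_eq
    by (intro convex_Int convex_INT convex_cball convex_hessian_pos_on_sublevel assms(2)) auto
  have "sdp (convex hull ?K)"
  proof (rule sdp_convex_hull_local[OF \<open>compact ?K\<close>])
    fix w assume w: "w \<in> ?K"
    have "\<exists>r. r > 0 \<and> sdp {x \<in> cball w r. F i x \<le> 0}" if "i \<in> I" for i
      using sdp_hessian_pos_on_local[OF assms(2)[OF that], of w] w by auto
    then obtain R where R: "\<And>i. i \<in> I \<Longrightarrow> R i > 0 \<and> sdp {x \<in> cball w (R i). F i x \<le> 0}" by metis
    \<comment> \<open>The inserted 1 keeps the minimum meaningful for empty
      \<open>I\<close>.\<close>
    define r where "r = Min (insert 1 (R ` I))"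
    have "r > 0" using R assms(1) by (auto simp: r_def)
    have "r \<le> R i" if "i \<in> I" for i using assms(1) that by (auto simp: r_def)
    then have C_eq: "cball w r \<inter> ?K = cball w r \<inter> cball u \<delta> \<inter> (\<Inter>i\<in>I. {x \<in> cball w (R i). F i x \<le> 0})"
      by (auto intro: order_trans)
    have "sdp (cball w r \<inter> ?K)"
      unfolding C_eq using R assms(1) by (intro sdp_Int sdp_cball sdp_INT) auto
    moreover have "compact (cball w r \<inter> ?K)" "convex (cball w r \<inter> ?K)"
      using \<open>compact ?K\<close> \<open>convex ?K\<close> by (auto intro: compact_Int convex_Int)
    moreover have "cball w r \<inter> ?K \<subseteq> convex hull ?K" by (rule order_trans[OF Int_lower2 hull_subset])
    moreover have "?K \<inter> ball w r \<subseteq> cball w r \<inter> ?K" by auto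
    ultimately show "\<exists>e>0. \<exists>C. sdp C \<and> compact C \<and> convex C \<and> C \<subseteq> convex hull ?K \<and> ?K \<inter> ball w e \<subseteq> C"
      using \<open>r > 0\<close> by blast
  qed
  then show ?thesis using \<open>convex ?K\<close> by (simp add: hull_same)
qed

text \<open>The midpoint \<open>z\<close> of two distinct points of \<open>K\<close> makes every
  \<open>F i\<close> negative, so it is not on the frontier. A segment from \<open>z\<close> to a
  supposed point \<open>x\<close> outside \<open>K\<close> crosses the frontier strictly between its
  ends, where strict convexity again makes every \<open>F i\<close> negative, although one of them
  must vanish.\<close>

lemma convex_eq_sublevels:
  fixes K :: "(real ^ 'n) set"
  assumes "closed K" "convex K" "x\<^sub>1 \<in> K" "x\<^sub>2 \<in> K" "x\<^sub>1 \<noteq> x\<^sub>2" "convex B"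
    and pd: "\<And>i. i \<in> I \<Longrightarrow> hessian_pos_on B (F i)"
    and sub: "K \<subseteq> {x \<in> B. \<forall>i\<in>I. F i x \<le> 0}"
    and frontier: "\<And>b. b \<in> frontier K \<Longrightarrow> \<exists>i\<in>I. F i b = 0"
  shows "K = {x \<in> B. \<forall>i\<in>I. F i x \<le> 0}"
proof (rule antisym[OF sub], rule subsetI, rule ccontr)
  fix x assume x: "x \<in> {x \<in> B. \<forall>i\<in>I. F i x \<le> 0}" "x \<notin> K"
  have strict: "F i ((1 - t) *\<^sub>R y + t *\<^sub>R y') < 0"
    if "i \<in> I" "y \<in> B" "y' \<in> B" "F i y \<le> 0" "F i y' \<le> 0" "y \<noteq> y'" "0 < t" "t < 1" for i y y' t
  proof -
    have "F i ((1 - t) *\<^sub>R y + t *\<^sub>R y') < (1 - t) * F i y + t * F i y'"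
      using that by (intro hessian_pos_on_strict(2)[OF pd assms(6)]) auto
    also have "\<dots> \<le> 0" using that by (intro add_nonpos_nonpos mult_nonneg_nonpos) auto
    finally show ?thesis .
  qed
  define z where "z = (1 - 1 / 2) *\<^sub>R x\<^sub>1 + (1 / 2) *\<^sub>R x\<^sub>2"
  have "z \<in> K" unfolding z_def using assms by (intro convexD) auto
  have "F i z < 0" if "i \<in> I" for i
    unfolding z_def using assms(3-5) sub that by (intro strict) auto
  then have z: "z \<notin> frontier K" using frontier by force
  have "closed_segment z x \<inter> frontier K \<noteq> {}"
    using \<open>z \<in> K\<close> x(2) by (intro connected_Int_frontier) auto
  then obtain b where "b \<in> frontier K" "b \<in> closed_segment z x" by blast
  then obtain t where b: "b \<in> frontier K" "0 \<le> t" "t \<le> 1" "b = (1 - t) *\<^sub>R z + t *\<^sub>R x"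
    unfolding in_segment by blast
  have "b \<in> K" using b(1) assms(1) by (auto simp: frontier_def)
  have "t \<noteq> 0" using b z by auto
  moreover have "t \<noteq> 1" using b \<open>b \<in> K\<close> x(2) by auto
  moreover have "z \<noteq> x" using \<open>z \<in> K\<close> x(2) by auto
  ultimately have "F i b < 0" if "i \<in> I" for i
    unfolding b(4) using that b(2,3) x(1) \<open>z \<in> K\<close> sub by (intro strict) auto
  with frontier[OF b(1)] show False by force
qed

section \<open>Lagrange functions of the constraints and the local hull\<close>

lemma gradient_lincomb:
  fixes f :: "'i \<Rightarrow> real ^ 'n \<Rightarrow> real" and g :: "'j \<Rightarrow> real ^ 'n \<Rightarrow> real"
    and c :: "'i \<Rightarrow> real" and d :: "'j \<Rightarrow> real"
  assumes "finite I" "finite J" "\<And>i. i \<in> I \<Longrightarrow> real_polynomial_function (f i)"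
    "\<And>j. j \<in> J \<Longrightarrow> real_polynomial_function (g j)"
  defines "F \<equiv> \<lambda>x. (\<Sum>i\<in>I. c i * f i x) + (\<Sum>j\<in>J. d j * g j x)"
  shows "real_polynomial_function F"
    and "gradient F x = (\<Sum>i\<in>I. c i *\<^sub>R gradient (f i) x) + (\<Sum>j\<in>J. d j *\<^sub>R gradient (g j) x)"
    and "hessian F x = (\<Sum>i\<in>I. c i *\<^sub>R hessian (f i) x) + (\<Sum>j\<in>J. d j *\<^sub>R hessian (g j) x)"
proof -
  have poly: "real_polynomial_function (\<lambda>x. \<Sum>i\<in>I. c i * f' i x)" if "\<And>i. i \<in> I \<Longrightarrow> real_polynomial_function (f' i)"
    for I and c :: "'k \<Rightarrow> real" and f' :: "'k \<Rightarrow> real ^ 'n \<Rightarrow> real"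
    using that by (cases "finite I") (auto intro!: real_polynomial_function_sum real_polynomial_function.intros(2,4))
  have part: "partial_deriv k (\<lambda>x. (\<Sum>i\<in>I. c i * f' i x) + (\<Sum>j\<in>J. d j * g' j x)) =
      (\<lambda>x. (\<Sum>i\<in>I. c i * partial_deriv k (f' i) x) + (\<Sum>j\<in>J. d j * partial_deriv k (g' j) x))"
    if "\<And>i. i \<in> I \<Longrightarrow> real_polynomial_function (f' i)" "\<And>j. j \<in> J \<Longrightarrow> real_polynomial_function (g' j)"
    for k and f' :: "'i \<Rightarrow> real ^ 'n \<Rightarrow> real" and g' :: "'j \<Rightarrow> real ^ 'n \<Rightarrow> real"
    by (subst partial_deriv_add[OF poly poly]) (use that assms(1,2) in \<open>simp_all add: partial_deriv_sum\<close>)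
  show "real_polynomial_function F"
    unfolding F_def using assms by (intro real_polynomial_function.intros(3) poly)
  show "gradient F x = (\<Sum>i\<in>I. c i *\<^sub>R gradient (f i) x) + (\<Sum>j\<in>J. d j *\<^sub>R gradient (g j) x)"
    unfolding F_def gradient_def using assms by (simp add: part vec_eq_iff)
  show "hessian F x = (\<Sum>i\<in>I. c i *\<^sub>R hessian (f i) x) + (\<Sum>j\<in>J. d j *\<^sub>R hessian (g j) x)"
    unfolding F_def hessian_def using assms
    by (simp add: part vec_eq_iff real_polynomial_function_partial_deriv)
qed

lemma real_polynomial_function_ball_constraint:
  "real_polynomial_function (\<lambda>x :: 'a::euclidean_space. \<delta>\<^sup>2 - (norm (x - u))\<^sup>2)"
proof -
  have "real_polynomial_function (\<lambda>x. (x - u) \<bullet> b)" for b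
    unfolding inner_diff_left
    by (intro real_polynomial_function_diff real_polynomial_function.intros(2))
      (rule real_polynomial_function.intros(1)[OF bounded_linear_inner_left])
  then have "real_polynomial_function (\<lambda>x. \<delta>\<^sup>2 - (\<Sum>b\<in>Basis. ((x - u) \<bullet> b) * ((x - u) \<bullet> b)))"
    by (intro real_polynomial_function_diff real_polynomial_function_sum real_polynomial_function.intros(2,4) finite_Basis)
  then show ?thesis by (simp add: euclidean_inner[symmetric] power2_norm_eq_inner)
qed

lemma feasible_set_ball_constraint:
  assumes "\<delta> > 0"
  shows "feasible_set m1 f (m2 + 1) (h(m2 + 1 := (\<lambda>x. \<delta>\<^sup>2 - (norm (x - u))\<^sup>2))) = feasible_set m1 f m2 h \<inter> cball u \<delta>"
proof -
  have "\<delta>\<^sup>2 - (norm (x - u))\<^sup>2 \<ge> 0 \<longleftrightarrow> x \<in> cball u \<delta>" for x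
    using assms by (simp add: dist_norm norm_minus_commute abs_le_square_iff[symmetric])
  moreover have "{1..m2 + 1} = insert (m2 + 1) {1..m2}" by auto
  ultimately show ?thesis by (auto simp: feasible_set_def)
qed

text \<open>The piece is cut out by the ball whose radius the PDLH condition supplies. The ball
  constraint becomes the last function \<open>g m\<close> and is treated like the other
  inequalities.\<close>

lemma sdp_convex_hull_PDLH_local:
  fixes f h :: "nat \<Rightarrow> real ^ 'n \<Rightarrow> real"
  assumes f: "\<And>i. i \<in> {1..m1} \<Longrightarrow> real_polynomial_function (f i)"
    and h: "\<And>j. j \<in> {1..m2} \<Longrightarrow> real_polynomial_function (h j)"
    and T: "T = feasible_set m1 f m2 h" "compact T" "u \<in> T"
    and PDLH: "PDLH m1 f m2 h u"
  shows "\<exists>\<delta>>0. sdp (convex hull (T \<inter> cball u \<delta>))"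
proof -
  define m where "m = m2 + 1"
  obtain \<delta> where "\<delta> > 0" and *: "\<forall>l \<delta>'. norm l = 1 \<and> 0 < \<delta>' \<and> \<delta>' \<le> \<delta> \<longrightarrow>
       (let m = m2 + 1; g = h(m := (\<lambda>x. \<delta>'\<^sup>2 - (norm (x - u))\<^sup>2)) in
         \<forall>v. is_global_minimizer l (feasible_set m1 f m g) v \<longrightarrow>
           (\<exists>lam mu. (\<forall>j\<in>{1..m}. mu j \<ge> 0) \<and>
              l = (\<Sum>i=1..m1. lam i *\<^sub>R gradient (f i) v) + (\<Sum>j=1..m. mu j *\<^sub>R gradient (g j) v) \<and>
              (\<forall>j\<in>{1..m}. mu j * g j v = 0) \<and>
              (\<forall>x. norm (x - u) \<le> \<delta>' \<longrightarrow>
                 pos_definite (- (\<Sum>i=1..m1. lam i *\<^sub>R hessian (f i) x)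
                               - (\<Sum>j=1..m. mu j *\<^sub>R hessian (g j) x)))))"
    using PDLH unfolding PDLH_def by blast
  define g where "g = h(m := (\<lambda>x. \<delta>\<^sup>2 - (norm (x - u))\<^sup>2))"
  define B where "B = cball u \<delta>"
  define S where "S = T \<inter> B"
  have S_eq: "S = feasible_set m1 f m g"
    unfolding S_def B_def T(1) m_def g_def using feasible_set_ball_constraint[OF \<open>\<delta> > 0\<close>] by metis
  have kkt: "\<exists>lam mu. (\<forall>j\<in>{1..m}. mu j \<ge> 0) \<and>
      l = (\<Sum>i=1..m1. lam i *\<^sub>R gradient (f i) v) + (\<Sum>j=1..m. mu j *\<^sub>R gradient (g j) v) \<and>
      (\<forall>j\<in>{1..m}. mu j * g j v = 0) \<and>
      (\<forall>x\<in>B. pos_definite (- (\<Sum>i=1..m1. lam i *\<^sub>R hessian (f i) x) - (\<Sum>j=1..m. mu j *\<^sub>R hessian (g j) x)))"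
    if "norm l = 1" "is_global_minimizer l S v" for l v
  proof -
    have "norm l = 1 \<and> 0 < \<delta> \<and> \<delta> \<le> \<delta>" using that(1) \<open>\<delta> > 0\<close> by simp
    note kkt = *[THEN spec, THEN spec, THEN mp, OF this, unfolded Let_def, folded m_def, folded g_def,
        folded S_eq, THEN spec, THEN mp, OF that(2)]
    have "x \<in> B \<longleftrightarrow> norm (x - u) \<le> \<delta>" for x by (simp add: B_def dist_norm norm_minus_commute)
    with kkt show ?thesis by (simp only: Ball_def)
  qed
  have g: "real_polynomial_function (g j)" if "j \<in> {1..m}" for j
    using h[of j] that real_polynomial_function_ball_constraint by (auto simp: g_def m_def)
  \<comment> \<open>The Lagrange function without its linear term \<open>l \<bullet> x\<close>: the
    Hessian is unchanged, and the first order condition reads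
    \<open>gradient F v = - l\<close>.\<close>
  define F where "F lam mu x = (\<Sum>i=1..m1. (- lam i) * f i x) + (\<Sum>j=1..m. (- mu j) * g j x)"
    for lam mu :: "nat \<Rightarrow> real" and x
  have F_poly: "real_polynomial_function (F lam mu)" for lam mu
    unfolding F_def using f g by (intro gradient_lincomb(1)) auto
  have F_grad: "gradient (F lam mu) x = - ((\<Sum>i=1..m1. lam i *\<^sub>R gradient (f i) x) + (\<Sum>j=1..m. mu j *\<^sub>R gradient (g j) x))" for lam mu x
    unfolding F_def using f g by (subst gradient_lincomb(2)) (auto simp: sum_negf)
  have F_hess: "hessian (F lam mu) x = - (\<Sum>i=1..m1. lam i *\<^sub>R hessian (f i) x) - (\<Sum>j=1..m. mu j *\<^sub>R hessian (g j) x)" for lam mu x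
    unfolding F_def using f g by (subst gradient_lincomb(3)) (auto simp: sum_negf)
  define good where "good lam mu \<longleftrightarrow> (\<forall>j\<in>{1..m}. mu j \<ge> 0) \<and> hessian_pos_on B (F lam mu)" for lam mu
  have "convex B" by (simp add: B_def)
  have "u \<in> S" using T(3) \<open>\<delta> > 0\<close> by (simp add: S_def B_def)
  have "compact S" using T(2) by (simp add: S_def B_def compact_Int)
  define K where "K = convex hull S"
  have K: "compact K" "closed K" "convex K"
    using \<open>compact S\<close> by (auto simp: K_def intro: compact_convex_hull compact_imp_closed)
  have F_le: "K \<subseteq> {x \<in> B. F lam mu x \<le> 0}" if "good lam mu" for lam mu
    unfolding K_def
  proof (rule hull_minimal)
    show "S \<subseteq> {x \<in> B. F lam mu x \<le> 0}"
    proof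
      fix x assume "x \<in> S"
      then have fx: "\<And>i. i \<in> {1..m1} \<Longrightarrow> f i x = 0" "\<And>j. j \<in> {1..m} \<Longrightarrow> g j x \<ge> 0"
        by (auto simp: S_eq feasible_set_def)
      then have "(\<Sum>j=1..m. (- mu j) * g j x) \<le> 0"
        using that by (intro sum_nonpos mult_nonpos_nonneg) (auto simp: good_def)
      with fx \<open>x \<in> S\<close> show "x \<in> {x \<in> B. F lam mu x \<le> 0}" by (simp add: F_def S_def)
    qed
    show "convex {x \<in> B. F lam mu x \<le> 0}"
      using that \<open>convex B\<close> by (intro convex_hessian_pos_on_sublevel) (auto simp: good_def)
  qed
  \<comment> \<open>Equality terms vanish on \<open>S\<close> whatever their multipliers are, so
    complementary slackness at \<open>x\<close> is all that is required.\<close>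
  have F_zero: "F lam mu x = 0" if "x \<in> S" "\<And>j. j \<in> {1..m} \<Longrightarrow> mu j * g j x = 0" for lam mu x
  proof -
    have "(\<Sum>i=1..m1. (- lam i) * f i x) = 0" "(\<Sum>j=1..m. (- mu j) * g j x) = 0"
      using that by (auto simp: S_eq feasible_set_def intro!: sum.neutral)
    then show ?thesis by (simp add: F_def)
  qed
  have frontier_kkt: "b \<in> S \<and> (\<exists>lam mu. good lam mu \<and> (\<forall>j\<in>{1..m}. mu j * g j b = 0))" if b: "b \<in> frontier K" for b
  proof -
    have "b \<in> K" using b K(2) by (auto simp: frontier_def)
    obtain l where l: "norm l = 1" "\<forall>y\<in>K. l \<bullet> b \<le> l \<bullet> y"
      using supporting_hyperplane_frontier[OF K(2,3) b] by blast
    have "continuous_on S (\<lambda>x. l \<bullet> x)" by (intro continuous_intros)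
    then obtain v where v: "v \<in> S" "\<forall>y\<in>S. l \<bullet> v \<le> l \<bullet> y"
      using continuous_attains_inf[OF \<open>compact S\<close>, of "\<lambda>x. l \<bullet> x"] \<open>u \<in> S\<close> by blast
    then have "is_global_minimizer l S v" by (simp add: is_global_minimizer_def)
    from kkt[OF l(1) this] obtain lam mu where mu: "\<forall>j\<in>{1..m}. mu j \<ge> 0" "\<forall>j\<in>{1..m}. mu j * g j v = 0"
      and l_eq: "l = - gradient (F lam mu) v" and pd: "\<forall>x\<in>B. pos_definite (hessian (F lam mu) x)"
      unfolding F_grad F_hess by auto
    have good: "good lam mu"
      using mu(1) pd F_poly by (auto simp: good_def hessian_pos_on_def pos_definite_def)
    have "v = b"
    proof (rule ccontr)
      assume "v \<noteq> b"
      have "b \<in> B" "F lam mu b \<le> 0" using F_le[OF good] \<open>b \<in> K\<close> by auto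
      moreover have "v \<in> B" using v(1) by (simp add: S_def)
      \<comment> \<open>Strict convexity gives \<open>F b > l \<bullet> v - l \<bullet> b\<close>.
        The right side is nonnegative because \<open>b\<close> minimizes \<open>l\<close> on the
        hull, while \<open>F b \<le> 0\<close>.\<close>
      ultimately have "F lam mu b > F lam mu v + gradient (F lam mu) v \<bullet> (b - v)"
        using good \<open>v \<noteq> b\<close> \<open>convex B\<close> by (intro hessian_pos_on_strict(1)) (auto simp: good_def)
      moreover have "F lam mu v = 0" using v(1) mu(2) by (intro F_zero) auto
      moreover have "gradient (F lam mu) v \<bullet> (b - v) = l \<bullet> v - l \<bullet> b"
        unfolding l_eq by (simp add: inner_diff_right)
      moreover have "l \<bullet> b \<le> l \<bullet> v" using l(2) v(1) by (simp add: K_def hull_inc)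
      ultimately show False using \<open>F lam mu b \<le> 0\<close> by simp
    qed
    with v(1) mu(2) good show ?thesis by blast
  qed
  \<comment> \<open>one Lagrange function per possible set of indices of positive multipliers: by complementary
    slackness it vanishes at every frontier point whose multipliers have that support\<close>
  define W where "W = {I. \<exists>lam mu. good lam mu \<and> I = {j \<in> {1..m}. mu j > 0}}"
  have "finite W" by (rule finite_subset[of _ "Pow {1..m}"]) (auto simp: W_def)
  have "\<forall>I\<in>W. \<exists>p. good (fst p) (snd p) \<and> I = {j \<in> {1..m}. snd p j > 0}"
    by (auto simp: W_def)
  from bchoice[OF this] obtain P
    where P: "\<forall>I\<in>W. good (fst (P I)) (snd (P I)) \<and> I = {j \<in> {1..m}. snd (P I) j > 0}" ..
  define Lam Mu where "Lam I = fst (P I)" and "Mu I = snd (P I)" for I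
  have W: "good (Lam I) (Mu I) \<and> I = {j \<in> {1..m}. Mu I j > 0}" if "I \<in> W" for I
    using P that unfolding Lam_def Mu_def by (rule bspec)
  have frontier: "\<exists>I\<in>W. F (Lam I) (Mu I) b = 0" if b: "b \<in> frontier K" for b
  proof -
    obtain lam mu where bS: "b \<in> S" and good: "good lam mu" and compl: "\<forall>j\<in>{1..m}. mu j * g j b = 0"
      using frontier_kkt[OF b] by blast
    define I where "I = {j \<in> {1..m}. mu j > 0}"
    have "I \<in> W" using good by (auto simp: W_def I_def)
    moreover have "F (Lam I) (Mu I) b = 0"
    proof (rule F_zero[OF bS])
      fix j assume j: "j \<in> {1..m}"
      show "Mu I j * g j b = 0"
      \<comment> \<open>The chosen \<open>Mu I\<close> and the multipliers at \<open>b\<close> are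
        positive at the same indices: inside \<open>I\<close> slackness gives
        \<open>g j b = 0\<close>, outside \<open>I\<close> the chosen multiplier is zero.\<close>
      proof (cases "j \<in> I")
        case True
        then have "mu j > 0" by (simp add: I_def)
        with compl[THEN bspec, OF j] have "g j b = 0" by simp
        then show ?thesis by simp
      next
        case False
        then have "\<not> Mu I j > 0" using W[OF \<open>I \<in> W\<close>] j by blast
        moreover have "Mu I j \<ge> 0" using W[OF \<open>I \<in> W\<close>] j by (simp add: good_def)
        ultimately show ?thesis by simp
      qed
    qed
    ultimately show ?thesis by blast
  qed
  have pd: "hessian_pos_on B (F (Lam I) (Mu I))" if "I \<in> W" for I
    using W[OF that] by (simp add: good_def)
  have "sdp K"
  \<comment> \<open>The sublevel description starts from a midpoint of two distinct points; a hull
    reduced to \<open>u\<close> is representable directly.\<close>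
  proof (cases "\<exists>x\<^sub>1\<in>K. \<exists>x\<^sub>2\<in>K. x\<^sub>1 \<noteq> x\<^sub>2")
    case True
    then obtain x\<^sub>1 x\<^sub>2 where x: "x\<^sub>1 \<in> K" "x\<^sub>2 \<in> K" "x\<^sub>1 \<noteq> x\<^sub>2" by blast
    have "K \<subseteq> B"
      unfolding K_def S_def using \<open>convex B\<close> by (intro hull_minimal) auto
    then have sub: "K \<subseteq> {x \<in> B. \<forall>I\<in>W. F (Lam I) (Mu I) x \<le> 0}" using F_le W by blast
    have "K = {x \<in> B. \<forall>I\<in>W. F (Lam I) (Mu I) x \<le> 0}"
      by (rule convex_eq_sublevels[OF K(2,3) x \<open>convex B\<close> pd sub frontier])
    also have "sdp \<dots>"
      unfolding B_def using pd \<open>finite W\<close> by (intro sdp_hessian_pos_on_sublevels) (auto simp: B_def)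
    finally show ?thesis .
  next
    case False
    moreover have "u \<in> K" using \<open>u \<in> S\<close> by (simp add: K_def hull_inc)
    ultimately have "K = {u}" by blast
    then show ?thesis by (simp add: sdp_singleton)
  qed
  with \<open>\<delta> > 0\<close> show ?thesis unfolding K_def S_def B_def by blast
qed

theorem theorem4p7:
  fixes f h :: "nat \<Rightarrow> real ^ 'n \<Rightarrow> real" and m1 m2 :: nat and T :: "(real ^ 'n) set"
  assumes "\<And>i. i \<in> {1..m1} \<Longrightarrow> real_polynomial_function (f i)"
    and "\<And>j. j \<in> {1..m2} \<Longrightarrow> real_polynomial_function (h j)"
    and "T = feasible_set m1 f m2 h"
    and "compact T"
    and "\<And>u. u \<in> convex_boundary T \<Longrightarrow> PDLH m1 f m2 h u"
  shows "SDP_representable (convex hull T)"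
proof -
  \<comment> \<open>The local argument runs over the convex boundary, where the PDLH condition is
    assumed; it is compact and has the same hull as \<open>T\<close>, so its local pieces yield the
    whole hull.\<close>
  let ?E = "convex_boundary T"
  have E: "?E = T \<inter> frontier (convex hull T)" using assms(4) by (rule convex_boundary_eq_frontier)
  have hull: "convex hull ?E = convex hull T" using assms(4) by (rule convex_hull_convex_boundary)
  have "compact ?E" unfolding E using assms(4) by (intro compact_Int_closed frontier_closed)
  then have "sdp (convex hull ?E)"
  proof (rule sdp_convex_hull_local)
    fix u assume u: "u \<in> ?E"
    then have "u \<in> T" by (simp add: E)
    then obtain \<delta> where "\<delta> > 0" "sdp (convex hull (T \<inter> cball u \<delta>))"
      using sdp_convex_hull_PDLH_local[OF assms(1-4) _ assms(5)[OF u]] by blast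
    moreover have "compact (convex hull (T \<inter> cball u \<delta>))"
      using assms(4) by (intro compact_convex_hull compact_Int compact_cball)
    moreover have "convex hull (T \<inter> cball u \<delta>) \<subseteq> convex hull ?E"
      unfolding hull by (intro hull_mono Int_lower1)
    moreover have "?E \<inter> ball u \<delta> \<subseteq> convex hull (T \<inter> cball u \<delta>)"
      by (rule order_trans[OF _ hull_subset]) (auto simp: E)
    ultimately show "\<exists>e>0. \<exists>C. sdp C \<and> compact C \<and> convex C \<and> C \<subseteq> convex hull ?E \<and> ?E \<inter> ball u e \<subseteq> C"
      using convex_convex_hull by blast
  qed
  then show ?thesis unfolding hull by (rule SDP_representable_if_sdp)
qed

end
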